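(* Let $M^n$ be an affine BSV torus of twistor rank $r$, with complex structure $J$. Then the complex manifold $(M,J)$ admits no pluriclosed Hermitian metric.
   Context: A Hermitian metric is called pluriclosed if its fundamental form $\eta$ satisfies $\partial\bar\partial\eta=0$. Space $Z_m$: for an oriented Euclidean real vector space $K$ of dimension $2m$, $Z_m=Z_m(K)\cong SO(2m)/U(m)$ is the set of all orthogonal complex structures $j$ on $K$ (linear isometries with $j^2=-1$) compatible with the orientation. It is a compact complex manifold; the complex structure on $T_jZ_m=\{\dot j \text{ skew-adjoint},\ \dot j j+j\dot j=0\}$ is $\dot j\mapsto j\dot j$. Equivalently, identifying $j$ with its $(-i)$-eigenspace in $K\otimes\mathbb C$, $Z_m$ is one component of the Grassmannian of maximal isotropic subspaces, a complex submanifold of $Gr(m,K\otimes\mathbb C)$. For $x\in Z_m$ write $J_x$ for the corresponding complex structure on $K$. Affine BSV torus of complex dimension $n$: a Hermitian manifold (up to holomorphic isometry) $(M,J,g)$, where $M=V/\Lambda$, $(V,g)$ is an oriented Euclidean vector space of real dimension $2n$, $\Lambda\subset V$ is a full lattice, and $J$ is built from the following data. There are an integer $0<r<n$ and an orthogonal decomposition $V=H\oplus K$ with $\dim_{\mathbb R}H=2r$; with $P_H:V\to H$ the orthogonal projection and $\Gamma=P_H(\Lambda)$, (1) $K$ is $\Lambda$-rational, i.e. $\Lambda_K=\Lambda\cap K$ is a full lattice in $K$ (hence $\Gamma$ is a full lattice in $H$); (2) $J_0$ is an orthogonal complex structure on $H$ making $B=H/\Gamma$ an abelian variety; (3) $f:B\to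 Z_{n-r}=Z_{n-r}(K)$ is a holomorphic map of generic (complex) rank $r$, where $K$ is oriented compatibly with $V$ and with the orientation of $H$ given by $J_0$. Then $J$ is the complex structure on $M$ induced by $J_{(h,k)}=J_0\oplus J_{f([h])}$ for $(h,k)\in H\oplus K=V$; it is integrable and compatible with the flat metric. Twistor rank: the generic complex rank of the twistor map $\tau:M\to Z_n(V)$, $p\mapsto J_p$ (tangent spaces identified with $V$ by a parallel frame). For an affine BSV torus it equals the integer $r=\dim_{\mathbb C}B$ above. *)

theory Defs
  imports "HOL-Analysis.Analysis" "HOL-Combinatorics.Permutations"
begin

section \<open>Smooth maps\<close>

primrec C_k :: "nat \<Rightarrow> ('a::real_normed_vector \<Rightarrow> 'b::real_normed_vector) \<Rightarrow> bool" where
  "C_k 0 F \<longleftrightarrow> continuous_on UNIV F"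
| "C_k (Suc k) F \<longleftrightarrow>
     (\<forall>x. F differentiable (at x)) \<and> (\<forall>v. C_k k (\<lambda>x. frechet_derivative F (at x) v))"

definition smooth_map :: "('a::real_normed_vector \<Rightarrow> 'b::real_normed_vector) \<Rightarrow> bool" where
  "smooth_map F \<longleftrightarrow> (\<forall>k. C_k k F)"

section \<open>Lattices, quotients and orthogonal projections\<close>

definition full_lattice :: "'a::real_vector set \<Rightarrow> 'a set \<Rightarrow> bool" where
  "full_lattice W L \<longleftrightarrow>
     (\<exists>B. finite B \<and> independent B \<and> span B = W \<and>
          L = {\<Sum>b\<in>B. of_int (c b) *\<^sub>R b | c. True})"

definition lcoset :: "'a::ab_group_add set \<Rightarrow> 'a \<Rightarrow> 'a set" where
  "lcoset L v = (\<lambda>l. v + l) ` L"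

definition torus :: "'a::ab_group_add set \<Rightarrow> 'a set \<Rightarrow> 'a set set" where
  "torus W L = lcoset L ` W"

definition orth_proj :: "'a::euclidean_space set \<Rightarrow> 'a \<Rightarrow> 'a" where
  "orth_proj W x = (THE y. y \<in> W \<and> (\<forall>w\<in>W. orthogonal (x - y) w))"

definition orth_decomp :: "'a::euclidean_space set \<Rightarrow> 'a set \<Rightarrow> bool" where
  "orth_decomp H K \<longleftrightarrow>
     subspace H \<and> subspace K \<and> (\<forall>h\<in>H. \<forall>k\<in>K. orthogonal h k) \<and>
     {h + k | h k. h \<in> H \<and> k \<in> K} = UNIV"

section \<open>Orientations\<close>

definition ordered_basis :: "'a::real_vector set \<Rightarrow> 'a list \<Rightarrow> bool" where
  "ordered_basis W bs \<longleftrightarrow> distinct bs \<and> independent (set bs) \<and> span (set bs) = W"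

text \<open>The determinant of the matrix expressing the basis \<open>cs\<close> in terms of the basis \<open>bs\<close>.\<close>

definition transition_det :: "'a::real_vector list \<Rightarrow> 'a list \<Rightarrow> real" where
  "transition_det bs cs =
     (\<Sum>p | p permutes {..<length bs}.
        of_int (sign p) * (\<Prod>i<length bs. representation (set bs) (cs ! p i) (bs ! i)))"

text \<open>An orientation of \<open>W\<close> is represented by the set of its positive ordered bases.\<close>

definition orientation_class :: "'a::real_vector set \<Rightarrow> 'a list \<Rightarrow> 'a list set" where
  "orientation_class W bs = {cs. ordered_basis W cs \<and> transition_det bs cs > 0}"

definition is_orientation :: "'a::real_vector set \<Rightarrow> 'a list set \<Rightarrow> bool" where
  "is_orientation W Or \<longleftrightarrow> (\<exists>bs. ordered_basis W bs \<and> Or = orientation_class W bs)"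

section \<open>Orthogonal complex structures and the space of all of them\<close>

text \<open>
  A linear endomorphism of a subspace \<open>W\<close> is represented by its extension by zero to the
  orthogonal complement of \<open>W\<close>. Thus the direct sum of endomorphisms of two orthogonal
  subspaces is the sum in \<^typ>\<open>'a \<Rightarrow>\<^sub>L 'a\<close>.
\<close>

definition orth_complex_structure ::
    "'a::euclidean_space set \<Rightarrow> ('a \<Rightarrow>\<^sub>L 'a) \<Rightarrow> bool" where
  "orth_complex_structure W j \<longleftrightarrow>
     (\<forall>w\<in>W. blinfun_apply j w \<in> W \<and> blinfun_apply j (blinfun_apply j w) = - w) \<and>
     (\<forall>u\<in>W. \<forall>w\<in>W. inner (blinfun_apply j u) (blinfun_apply j w) = inner u w) \<and>
     (\<forall>u. (\<forall>w\<in>W. orthogonal u w) \<longrightarrow> blinfun_apply j u = 0)"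

text \<open>The bases \<open>w\<^sub>1, j w\<^sub>1, \<dots>, w\<^sub>m, j w\<^sub>m\<close> are positive for the orientation given by \<open>j\<close>.\<close>

definition complex_orientation ::
    "'a::euclidean_space set \<Rightarrow> ('a \<Rightarrow>\<^sub>L 'a) \<Rightarrow> 'a list set" where
  "complex_orientation W j =
     {cs. \<exists>ws. let bs = concat (map (\<lambda>w. [w, blinfun_apply j w]) ws)
               in ordered_basis W bs \<and> cs \<in> orientation_class W bs}"

definition twistor_space ::
    "'a::euclidean_space set \<Rightarrow> 'a list set \<Rightarrow> ('a \<Rightarrow>\<^sub>L 'a) set" where
  "twistor_space W Or = {j. orth_complex_structure W j \<and> complex_orientation W j = Or}"

text \<open>The orientation of \<open>K\<close> for which \<open>H \<oplus> K\<close> has the orientation \<open>Or\<close>, where \<open>H\<close> has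
  the orientation \<open>OrH\<close>.\<close>

definition complement_orientation ::
    "'a::real_vector list set \<Rightarrow> 'a list set \<Rightarrow> 'a set \<Rightarrow> 'a list set" where
  "complement_orientation Or OrH K = {ks. ordered_basis K ks \<and> (\<exists>hs\<in>OrH. hs @ ks \<in> Or)}"

text \<open>The complex structure on the tangent space at \<open>j\<close> of the space of complex structures.\<close>

definition twistor_tangent_J :: "('a::euclidean_space \<Rightarrow>\<^sub>L 'a) \<Rightarrow> ('a \<Rightarrow>\<^sub>L 'a) \<Rightarrow> ('a \<Rightarrow>\<^sub>L 'a)" where
  "twistor_tangent_J j jdot = j o\<^sub>L jdot"

section \<open>Abelian varieties\<close>

text \<open>The complex torus \<open>(H, J0)/\<Gamma>\<close> is an abelian variety if it carries a polarization: a
  positive definite Hermitian form on \<open>(H, J0)\<close> whose imaginary part \<open>E\<close> is integral on \<open>\<Gamma>\<close>.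
  The Hermitian form is \<open>E (J0 x) y + \<i> E x y\<close>. Only the restriction of \<open>E\<close> to \<open>H\<close> matters.\<close>

definition abelian_variety ::
    "'a::euclidean_space set \<Rightarrow> ('a \<Rightarrow>\<^sub>L 'a) \<Rightarrow> 'a set \<Rightarrow> bool" where
  "abelian_variety H J0 \<Gamma> \<longleftrightarrow>
     full_lattice H \<Gamma> \<and>
     (\<exists>E :: 'a \<Rightarrow> 'a \<Rightarrow> real.
        bilinear E \<and>
        (\<forall>x\<in>H. \<forall>y\<in>H. E x y = - E y x) \<and>
        (\<forall>x\<in>H. \<forall>y\<in>H. E (blinfun_apply J0 x) (blinfun_apply J0 y) = E x y) \<and>
        (\<forall>x\<in>H. x \<noteq> 0 \<longrightarrow> E (blinfun_apply J0 x) x > 0) \<and>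
        (\<forall>x\<in>\<Gamma>. \<forall>y\<in>\<Gamma>. E x y \<in> \<int>))"

section \<open>Affine BSV tori\<close>

text \<open>A map on the torus \<open>W/L\<close> is studied through its lift to \<open>W\<close>, which is precomposed with
  the orthogonal projection to \<open>W\<close> so that it is defined on the whole space; its derivatives
  along \<open>W\<close> are those of the lift.\<close>

definition torus_lift ::
    "'a::euclidean_space set \<Rightarrow> 'a set \<Rightarrow> ('a set \<Rightarrow> 'b) \<Rightarrow> 'a \<Rightarrow> 'b" where
  "torus_lift W L F x = F (lcoset L (orth_proj W x))"

definition holomorphic_to_twistor_space ::
    "'a::euclidean_space set \<Rightarrow> 'a set \<Rightarrow> ('a \<Rightarrow>\<^sub>L 'a) \<Rightarrow> 'a set \<Rightarrow> 'a list set \<Rightarrow>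
     ('a set \<Rightarrow> ('a \<Rightarrow>\<^sub>L 'a)) \<Rightarrow> bool" where
  "holomorphic_to_twistor_space H \<Gamma> J0 K OrK f \<longleftrightarrow>
     (\<forall>b\<in>torus H \<Gamma>. f b \<in> twistor_space K OrK) \<and>
     smooth_map (torus_lift H \<Gamma> f) \<and>
     (\<forall>h\<in>H. \<forall>u\<in>H.
        frechet_derivative (torus_lift H \<Gamma> f) (at h) (blinfun_apply J0 u) =
        twistor_tangent_J (f (lcoset \<Gamma> h)) (frechet_derivative (torus_lift H \<Gamma> f) (at h) u))"

text \<open>The complex rank is half of the real dimension of the image of the differential; generic
  means on a dense open set.\<close>

definition has_generic_complex_rank ::
    "'a::euclidean_space set \<Rightarrow> 'a set \<Rightarrow> ('a set \<Rightarrow> ('a \<Rightarrow>\<^sub>L 'a)) \<Rightarrow> nat \<Rightarrow> bool" where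
  "has_generic_complex_rank W L F r \<longleftrightarrow>
     (\<exists>U. openin (top_of_set W) U \<and> W \<subseteq> closure U \<and>
        (\<forall>x\<in>U. dim (frechet_derivative (torus_lift W L F) (at x) ` W) = 2 * r))"

text \<open>\<open>V\<close> is the whole type with orientation \<open>Or\<close>, and \<open>M = V/L\<close>. The tangent spaces of \<open>M\<close> are
  identified with \<open>V\<close>, so that an almost complex structure on \<open>M\<close> is a map from \<open>M\<close> to the
  endomorphisms of \<open>V\<close>.\<close>

definition affine_BSV_torus ::
    "nat \<Rightarrow> 'a::euclidean_space list set \<Rightarrow> 'a set \<Rightarrow> ('a set \<Rightarrow> ('a \<Rightarrow>\<^sub>L 'a)) \<Rightarrow> bool" where
  "affine_BSV_torus n Or L J \<longleftrightarrow>
     DIM('a) = 2 * n \<and> is_orientation UNIV Or \<and> full_lattice UNIV L \<and>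
     (\<exists>r H K J0 f.
        0 < r \<and> r < n \<and> orth_decomp H K \<and> dim H = 2 * r \<and>
        full_lattice K (L \<inter> K) \<and>
        (let \<Gamma> = orth_proj H ` L;
             OrK = complement_orientation Or (complex_orientation H J0) K
         in orth_complex_structure H J0 \<and>
            abelian_variety H J0 \<Gamma> \<and>
            holomorphic_to_twistor_space H \<Gamma> J0 K OrK f \<and>
            has_generic_complex_rank H \<Gamma> f r \<and>
            (\<forall>h\<in>H. \<forall>k\<in>K. J (lcoset L (h + k)) = J0 + f (lcoset \<Gamma> h))))"

text \<open>In the parallel frame, the twistor map \<open>p \<mapsto> J\<^sub>p\<close> is \<open>J\<close> itself.\<close>

definition has_twistor_rank ::
    "'a::euclidean_space set \<Rightarrow> ('a set \<Rightarrow> ('a \<Rightarrow>\<^sub>L 'a)) \<Rightarrow> nat \<Rightarrow> bool" where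
  "has_twistor_rank L J r \<longleftrightarrow> has_generic_complex_rank UNIV L J r"

section \<open>Differential forms, types, and the operators \<open>\<partial>\<close> and \<open>\<partial>\<close>-bar\<close>

text \<open>
  Complex-valued \<open>k\<close>-forms on \<open>V/L\<close> are given by their pullbacks to \<open>V\<close>: a form \<open>\<alpha>\<close> takes a point
  and the list of its \<open>k\<close> arguments. An element \<open>a + \<i> b\<close> of the complexification of \<open>V\<close> is the
  pair \<open>(a, b)\<close>, and \<open>complexify\<close> extends a real-multilinear map complex-multilinearly.
\<close>

fun complexify :: "('a list \<Rightarrow> complex) \<Rightarrow> ('a \<times> 'a) list \<Rightarrow> complex" where
  "complexify \<alpha> [] = \<alpha> []"
| "complexify \<alpha> (z # zs) =
     complexify (\<lambda>vs. \<alpha> (fst z # vs)) zs + \<i> * complexify (\<lambda>vs. \<alpha> (snd z # vs)) zs"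

text \<open>\<open>v = v\<^sup>1\<^sup>0 + v\<^sup>0\<^sup>1\<close> with \<open>v\<^sup>1\<^sup>0 = (v - \<i> j v)/2\<close> in the \<open>\<i>\<close>-eigenspace of \<open>j\<close> and
  \<open>v\<^sup>0\<^sup>1 = (v + \<i> j v)/2\<close> in the \<open>(-\<i>)\<close>-eigenspace.\<close>

definition part10 :: "('a::real_normed_vector \<Rightarrow>\<^sub>L 'a) \<Rightarrow> 'a \<Rightarrow> 'a \<times> 'a" where
  "part10 j v = ((1/2) *\<^sub>R v, - (1/2) *\<^sub>R blinfun_apply j v)"

definition part01 :: "('a::real_normed_vector \<Rightarrow>\<^sub>L 'a) \<Rightarrow> 'a \<Rightarrow> 'a \<times> 'a" where
  "part01 j v = ((1/2) *\<^sub>R v, (1/2) *\<^sub>R blinfun_apply j v)"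

text \<open>The \<open>(p,q)\<close>-component, with respect to \<open>j\<close>, of an alternating \<open>(p+q)\<close>-linear map.\<close>

definition type_part ::
    "('a::real_normed_vector \<Rightarrow>\<^sub>L 'a) \<Rightarrow> nat \<Rightarrow> nat \<Rightarrow> ('a list \<Rightarrow> complex) \<Rightarrow> 'a list \<Rightarrow> complex" where
  "type_part j p q \<alpha> vs =
     (if length vs = p + q
      then \<Sum>S | S \<subseteq> {..<p + q} \<and> card S = p.
             complexify \<alpha>
               (map (\<lambda>i. if i \<in> S then part10 j (vs ! i) else part01 j (vs ! i)) [0..<p + q])
      else 0)"

text \<open>The usual formula for the exterior derivative, evaluated on constant vector fields.\<close>

definition ext_deriv ::
    "('a::real_normed_vector \<Rightarrow> 'a list \<Rightarrow> complex) \<Rightarrow> 'a \<Rightarrow> 'a list \<Rightarrow> complex" where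
  "ext_deriv \<alpha> x vs =
     (\<Sum>i<length vs.
        (-1) ^ i * frechet_derivative (\<lambda>y. \<alpha> y (take i vs @ drop (Suc i) vs)) (at x) (vs ! i))"

text \<open>\<open>del J p q\<close> and \<open>delbar J p q\<close> are \<open>\<partial>\<close> and its conjugate on forms of type \<open>(p,q)\<close>, for the
  complex structure \<open>J\<close> on \<open>V\<close>.\<close>

definition del ::
    "('a::real_normed_vector \<Rightarrow> ('a \<Rightarrow>\<^sub>L 'a)) \<Rightarrow> nat \<Rightarrow> nat \<Rightarrow>
     ('a \<Rightarrow> 'a list \<Rightarrow> complex) \<Rightarrow> 'a \<Rightarrow> 'a list \<Rightarrow> complex" where
  "del J p q \<alpha> = (\<lambda>x. type_part (J x) (Suc p) q (ext_deriv \<alpha> x))"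

definition delbar ::
    "('a::real_normed_vector \<Rightarrow> ('a \<Rightarrow>\<^sub>L 'a)) \<Rightarrow> nat \<Rightarrow> nat \<Rightarrow>
     ('a \<Rightarrow> 'a list \<Rightarrow> complex) \<Rightarrow> 'a \<Rightarrow> 'a list \<Rightarrow> complex" where
  "delbar J p q \<alpha> = (\<lambda>x. type_part (J x) p (Suc q) (ext_deriv \<alpha> x))"

section \<open>Pluriclosed Hermitian metrics on \<open>V/L\<close>\<close>

definition hermitian_metric ::
    "'a::euclidean_space set \<Rightarrow> ('a set \<Rightarrow> ('a \<Rightarrow>\<^sub>L 'a)) \<Rightarrow> ('a set \<Rightarrow> 'a \<Rightarrow> 'a \<Rightarrow> real) \<Rightarrow> bool" where
  "hermitian_metric L J g \<longleftrightarrow>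
     (\<forall>u v. smooth_map (\<lambda>x. g (lcoset L x) u v)) \<and>
     (\<forall>p\<in>torus UNIV L.
        bilinear (g p) \<and>
        (\<forall>u v. g p u v = g p v u) \<and>
        (\<forall>u. u \<noteq> 0 \<longrightarrow> g p u u > 0) \<and>
        (\<forall>u v. g p (blinfun_apply (J p) u) (blinfun_apply (J p) v) = g p u v))"

definition fundamental_form ::
    "'a::euclidean_space set \<Rightarrow> ('a set \<Rightarrow> ('a \<Rightarrow>\<^sub>L 'a)) \<Rightarrow> ('a set \<Rightarrow> 'a \<Rightarrow> 'a \<Rightarrow> real) \<Rightarrow>
     'a \<Rightarrow> 'a list \<Rightarrow> complex" where
  "fundamental_form L J g x vs =
     (let p = lcoset L x in of_real (g p (blinfun_apply (J p) (vs ! 0)) (vs ! 1)))"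

definition pluriclosed ::
    "'a::euclidean_space set \<Rightarrow> ('a set \<Rightarrow> ('a \<Rightarrow>\<^sub>L 'a)) \<Rightarrow> ('a set \<Rightarrow> 'a \<Rightarrow> 'a \<Rightarrow> real) \<Rightarrow> bool" where
  "pluriclosed L J g \<longleftrightarrow>
     (let Jl = (\<lambda>x. J (lcoset L x))
      in \<forall>x vs. length vs = 4 \<longrightarrow>
           del Jl 1 2 (delbar Jl 1 1 (fundamental_form L J g)) x vs = 0)"

end

theory Submission
  imports Defs
begin

text \<open>
  Let \<open>w(a,b) = g(J a, b)\<close> be the fundamental form of a pluriclosed metric. Fix \<open>k \<in> K\<close> and
  \<open>h \<in> H\<close>, and evaluate \<open>\<partial>\<close>\<open>\<partial>\<close>-bar of \<open>w\<close> on \<open>(k, J k, h, J h)\<close>. The vector field \<open>J k\<close> is not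
  constant, but it depends only on the base point in \<open>H\<close>. Hence, modulo terms whose integral over
  the torus vanishes, one may drop all derivatives along \<open>K\<close> and integrate by parts along \<open>H\<close>.
  With \<open>P\<close> the derivative of \<open>J\<close> in the direction \<open>h\<close>, the derivative in the direction \<open>J h\<close> is
  \<open>J P\<close> by holomorphy, and the second derivatives of \<open>J\<close> are eliminated because holomorphic maps
  are harmonic. What remains is a nonzero multiple of \<open>w(P k, J P k) = g(P k, P k)\<close>. So the
  integral of \<open>g(P k, P k)\<close> vanishes, \<open>P k = 0\<close>, and \<open>f\<close> has rank zero.
\<close>

section \<open>Calculus of smooth maps\<close>

definition dirderiv :: "'a::real_normed_vector \<Rightarrow> ('a \<Rightarrow> 'b::real_normed_vector) \<Rightarrow> 'a \<Rightarrow> 'b" where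
  "dirderiv v F x = frechet_derivative F (at x) v"

lemma C_k_Suc_iff:
  "C_k (Suc k) F \<longleftrightarrow> (\<forall>x. F differentiable (at x)) \<and> (\<forall>v. C_k k (dirderiv v F))"
  by (simp add: dirderiv_def[abs_def])

declare C_k.simps(2) [simp del]

lemma C_k_lower: "C_k (Suc k) F \<Longrightarrow> C_k k F"
proof (induction k arbitrary: F)
  case 0
  then show ?case
    by (auto simp: C_k_Suc_iff continuous_on_eq_continuous_at differentiable_imp_continuous_within)
next
  case (Suc k)
  then show ?case unfolding C_k_Suc_iff[of "Suc k"] C_k_Suc_iff[of k F] by blast
qed

lemma has_derivative_dirderiv:
  "F differentiable (at x) \<Longrightarrow> (F has_derivative (\<lambda>v. dirderiv v F x)) (at x)"
  unfolding dirderiv_def by (simp add: frechet_derivative_works)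

lemma dirderiv_eqI: "(F has_derivative F') (at x) \<Longrightarrow> dirderiv v F x = F' v"
  unfolding dirderiv_def by (metis frechet_derivative_at)

lemma linear_dirderiv: "F differentiable (at x) \<Longrightarrow> linear (\<lambda>v. dirderiv v F x)"
  unfolding dirderiv_def by (simp add: linear_frechet_derivative)

lemma dirderiv_const [simp]: "dirderiv v (\<lambda>x. c) x = 0"
  by (rule dirderiv_eqI[OF has_derivative_const])

lemma dirderiv_add:
  assumes "F differentiable (at x)" "G differentiable (at x)"
  shows "dirderiv v (\<lambda>x. F x + G x) x = dirderiv v F x + dirderiv v G x"
  by (rule dirderiv_eqI[OF has_derivative_add[OF assms[THEN has_derivative_dirderiv]]])

lemma dirderiv_bilinear:
  assumes "bounded_bilinear p" "F differentiable (at x)" "G differentiable (at x)"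
  shows "dirderiv v (\<lambda>x. p (F x) (G x)) x = p (F x) (dirderiv v G x) + p (dirderiv v F x) (G x)"
  by (rule dirderiv_eqI[OF bounded_bilinear.FDERIV[OF assms(1) assms(2,3)[THEN has_derivative_dirderiv]]])

lemma dirderiv_linear:
  assumes "bounded_linear p" "F differentiable (at x)"
  shows "dirderiv v (\<lambda>x. p (F x)) x = p (dirderiv v F x)"
  by (rule dirderiv_eqI[OF bounded_linear.has_derivative[OF assms(1) assms(2)[THEN has_derivative_dirderiv]]])

section \<open>Closure properties of differentiability classes and of invariant smooth maps\<close>

lemma C_k_const [simp]: "C_k k (\<lambda>x. c)"
proof (induction k arbitrary: c)
  case (Suc k)
  then show ?case by (simp add: C_k_Suc_iff dirderiv_const[abs_def])
qed simp

lemma C_k_add: "C_k k F \<Longrightarrow> C_k k G \<Longrightarrow> C_k k (\<lambda>x. F x + G x)"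
proof (induction k arbitrary: F G)
  case (Suc k)
  have "dirderiv v (\<lambda>x. F x + G x) = (\<lambda>x. dirderiv v F x + dirderiv v G x)" for v
    using Suc.prems by (auto simp: C_k_Suc_iff intro!: ext dirderiv_add)
  then show ?case using Suc by (auto simp: C_k_Suc_iff)
qed (auto intro: continuous_intros)

lemma C_k_linear: "bounded_linear p \<Longrightarrow> C_k k F \<Longrightarrow> C_k k (\<lambda>x. p (F x))"
proof (induction k arbitrary: F)
  case (Suc k)
  have "dirderiv v (\<lambda>x. p (F x)) = (\<lambda>x. p (dirderiv v F x))" for v
    using Suc.prems by (auto simp: C_k_Suc_iff intro!: ext dirderiv_linear)
  moreover have "(\<lambda>x. p (F x)) differentiable (at x)" for x
    using Suc.prems unfolding C_k_Suc_iff
    by (blast intro: differentiableI bounded_linear.has_derivative has_derivative_dirderiv)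
  ultimately show ?case using Suc by (auto simp: C_k_Suc_iff)
qed (auto intro: bounded_linear.continuous_on)

lemma C_k_bilinear:
  "bounded_bilinear p \<Longrightarrow> C_k k F \<Longrightarrow> C_k k G \<Longrightarrow> C_k k (\<lambda>x. p (F x) (G x))"
proof (induction k arbitrary: F G)
  case (Suc k)
  have "dirderiv v (\<lambda>x. p (F x) (G x)) = (\<lambda>x. p (F x) (dirderiv v G x) + p (dirderiv v F x) (G x))" for v
    using Suc.prems by (auto simp: C_k_Suc_iff intro!: ext dirderiv_bilinear)
  moreover have "(\<lambda>x. p (F x) (G x)) differentiable (at x)" for x
    using Suc.prems unfolding C_k_Suc_iff
    by (blast intro: differentiableI bounded_bilinear.FDERIV has_derivative_dirderiv)
  ultimately show ?case
    using Suc.IH[OF Suc.prems(1)] Suc.prems(2,3)[THEN C_k_lower] Suc.prems(2,3)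
    by (auto simp: C_k_Suc_iff intro!: C_k_add)
qed (auto intro: bounded_bilinear.continuous_on)

text \<open>Invariance under \<open>S\<close> is carried along with smoothness because it passes to derivatives;
  \<open>S\<close> will be the lattice, or the lattice together with \<open>K\<close>.\<close>

definition smooth_inv :: "'a::real_normed_vector set \<Rightarrow> ('a \<Rightarrow> 'b::real_normed_vector) \<Rightarrow> bool" where
  "smooth_inv S F \<longleftrightarrow> smooth_map F \<and> (\<forall>x. \<forall>s\<in>S. F (x + s) = F x)"

lemma smooth_inv_shift: "smooth_inv S F \<Longrightarrow> s \<in> S \<Longrightarrow> F (x + s) = F x"
  by (simp add: smooth_inv_def)

lemma smooth_inv_mono: "smooth_inv S F \<Longrightarrow> S' \<subseteq> S \<Longrightarrow> smooth_inv S' F"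
  by (auto simp: smooth_inv_def)

lemma smooth_inv_differentiable [intro]: "smooth_inv S F \<Longrightarrow> F differentiable (at x)"
  unfolding smooth_inv_def smooth_map_def by (metis C_k_Suc_iff)

lemma smooth_inv_continuous: "smooth_inv S F \<Longrightarrow> continuous_on A F"
  unfolding smooth_inv_def smooth_map_def by (metis C_k.simps(1) continuous_on_subset subset_UNIV)

lemma smooth_inv_const [simp, intro]: "smooth_inv S (\<lambda>x. c)"
  by (simp add: smooth_inv_def smooth_map_def)

lemma smooth_inv_add [intro]:
  "smooth_inv S F \<Longrightarrow> smooth_inv S G \<Longrightarrow> smooth_inv S (\<lambda>x. F x + G x)"
  by (simp add: smooth_inv_def smooth_map_def C_k_add)

lemma smooth_inv_linear:
  "bounded_linear p \<Longrightarrow> smooth_inv S F \<Longrightarrow> smooth_inv S (\<lambda>x. p (F x))"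
  by (simp add: smooth_inv_def smooth_map_def C_k_linear)

lemma smooth_inv_bilinear:
  "bounded_bilinear p \<Longrightarrow> smooth_inv S F \<Longrightarrow> smooth_inv S G \<Longrightarrow> smooth_inv S (\<lambda>x. p (F x) (G x))"
  by (simp add: smooth_inv_def smooth_map_def C_k_bilinear)

lemma smooth_inv_minus [intro]: "smooth_inv S F \<Longrightarrow> smooth_inv S (\<lambda>x. - F x)"
  by (rule smooth_inv_linear[OF bounded_linear_minus[OF bounded_linear_ident]])

lemma smooth_inv_diff [intro]:
  "smooth_inv S F \<Longrightarrow> smooth_inv S G \<Longrightarrow> smooth_inv S (\<lambda>x. F x - G x)"
  using smooth_inv_add[of S F "\<lambda>x. - G x"] by auto

lemma smooth_inv_sum [intro]:
  "(\<And>i. i \<in> A \<Longrightarrow> smooth_inv S (F i)) \<Longrightarrow> smooth_inv S (\<lambda>x. \<Sum>i\<in>A. F i x)"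
  by (induction A rule: infinite_finite_induct) auto

text \<open>Differentiability is not at issue: translation identifies the candidates for the
  derivative at both points, and \<open>frechet_derivative\<close> chooses from that same
  set.\<close>

lemma dirderiv_shift:
  assumes "\<And>x. F (x + s) = F x"
  shows "dirderiv v F (x + s) = dirderiv v F x"
proof -
  have "(F has_derivative D) (at (x + s)) \<longleftrightarrow> (F has_derivative D) (at x)" for D
  proof
    assume a: "(F has_derivative D) (at (x + s))"
    have "((\<lambda>y. y + s) has_derivative (\<lambda>y. y)) (at x)" by (auto intro!: derivative_eq_intros)
    from has_derivative_compose[OF this a] show "(F has_derivative D) (at x)" by (simp add: assms)
  next
    assume a: "(F has_derivative D) (at x)"
    have "((\<lambda>y. y - s) has_derivative (\<lambda>y. y)) (at (x + s))" by (auto intro!: derivative_eq_intros)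
    from has_derivative_compose[OF this, of F D] a
    show "(F has_derivative D) (at (x + s))" using assms[of "_ - s"] by simp
  qed
  then show ?thesis unfolding dirderiv_def frechet_derivative_def by simp
qed

lemma smooth_inv_dirderiv [intro]: "smooth_inv S F \<Longrightarrow> smooth_inv S (dirderiv v F)"
  unfolding smooth_inv_def smooth_map_def by (metis C_k_Suc_iff dirderiv_shift)

lemma dirderiv_eq_0_if_invariant:
  assumes "F differentiable (at x)" "\<And>t. F (x + t *\<^sub>R s) = F x"
  shows "dirderiv s F x = 0"
proof -
  have "((\<lambda>t. x + t *\<^sub>R s) has_derivative (\<lambda>t. t *\<^sub>R s)) (at 0)"
    by (auto intro!: derivative_eq_intros)
  moreover have "(F has_derivative (\<lambda>v. dirderiv v F x)) (at (x + 0 *\<^sub>R s))"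
    using has_derivative_dirderiv[OF assms(1)] by simp
  ultimately have "((\<lambda>t. F (x + t *\<^sub>R s)) has_derivative (\<lambda>t. dirderiv (t *\<^sub>R s) F x)) (at 0)"
    by (rule has_derivative_compose)
  from dirderiv_eqI[OF this, of 1] show ?thesis by (simp add: assms)
qed

lemma dirderiv_along_eq:
  assumes "smooth_inv S F"
  shows "((\<lambda>t. F (x + t *\<^sub>R v)) has_vector_derivative dirderiv v F (x + t *\<^sub>R v)) (at t within U)"
proof -
  have "((\<lambda>t. x + t *\<^sub>R v) has_derivative (\<lambda>t. t *\<^sub>R v)) (at t within U)"
    by (auto intro!: derivative_eq_intros)
  moreover have "(F has_derivative (\<lambda>w. dirderiv w F (x + t *\<^sub>R v))) (at (x + t *\<^sub>R v))"
    using assms by (intro has_derivative_dirderiv) auto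
  ultimately have "((\<lambda>t. F (x + t *\<^sub>R v)) has_derivative (\<lambda>s. dirderiv (s *\<^sub>R v) F (x + t *\<^sub>R v))) (at t within U)"
    by (rule has_derivative_compose)
  then show ?thesis
    using linear_scale[OF linear_dirderiv[OF smooth_inv_differentiable[OF assms]]]
    by (simp add: has_vector_derivative_def)
qed

text \<open>Symmetry of second derivatives. The increment of \<open>F\<close> along \<open>u\<close>
  is the integral of \<open>dirderiv u F\<close>; differentiating it along \<open>v\<close> under
  the integral sign, and then in the upper limit, produces the two mixed derivatives.\<close>

lemma dirderiv_commute:
  fixes F :: "'a::real_normed_vector \<Rightarrow> 'b::banach"
  assumes F: "smooth_inv S F"
  shows "dirderiv u (dirderiv v F) x = dirderiv v (dirderiv u F) x"
proof -
  let ?q = "\<lambda>(s::real) (t::real). x + s *\<^sub>R v + t *\<^sub>R u"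
  have Fu: "smooth_inv S (dirderiv u F)" and Fv: "smooth_inv S (dirderiv v F)"
    and Fuv: "smooth_inv S (dirderiv v (dirderiv u F))" using F by blast+
  have swap: "?q s t = (x + t *\<^sub>R u) + s *\<^sub>R v" for s t by (simp add: algebra_simps)
  have cont: "continuous_on A (\<lambda>z. dirderiv v (dirderiv u F) (?q (f z) (g z)))"
    if "continuous_on A f" "continuous_on A g" for A :: "'c::topological_space set" and f g
    by (rule continuous_on_compose2[OF smooth_inv_continuous[OF Fuv, of UNIV]])
       (auto intro!: continuous_intros that)
  have fund: "integral {0..t} (\<lambda>\<tau>. dirderiv u F (?q s \<tau>)) = F (?q s t) - F (?q s 0)" if "0 \<le> t" for s t
    using that by (intro integral_unique fundamental_theorem_of_calculus dirderiv_along_eq[OF F]) auto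
  \<comment> \<open>Both sides are the derivative at s = 0 of
    \<open>F (?q s t) - F (?q s 0)\<close>; the right side comes from the Leibniz rule applied to
    \<open>fund\<close>.\<close>
  have main: "dirderiv v F (?q 0 t) - dirderiv v F x = integral {0..t} (\<lambda>\<tau>. dirderiv v (dirderiv u F) (?q 0 \<tau>))"
    if t: "0 \<le> t" for t
  proof -
    have "((\<lambda>s. integral (cbox 0 t) (\<lambda>\<tau>. dirderiv u F (?q s \<tau>))) has_vector_derivative
        integral (cbox 0 t) (\<lambda>\<tau>. dirderiv v (dirderiv u F) (?q 0 \<tau>))) (at 0 within UNIV)"
    proof (rule leibniz_rule_vector_derivative)
      show "((\<lambda>s. dirderiv u F (?q s \<tau>)) has_vector_derivative dirderiv v (dirderiv u F) (?q s \<tau>)) (at s within UNIV)" for s \<tau>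
        unfolding swap by (rule dirderiv_along_eq[OF Fu])
      show "(\<lambda>\<tau>. dirderiv u F (?q s \<tau>)) integrable_on cbox 0 t" for s
        by (intro integrable_continuous continuous_on_compose2[OF smooth_inv_continuous[OF Fu, of UNIV]])
           (auto intro!: continuous_intros)
      show "continuous_on (UNIV \<times> cbox 0 t) (\<lambda>(s, \<tau>). dirderiv v (dirderiv u F) (?q s \<tau>))"
        unfolding split_beta by (rule cont) (auto intro!: continuous_intros)
    qed auto
    moreover have "((\<lambda>s. F (?q s t) - F (?q s 0)) has_vector_derivative
        (dirderiv v F (?q 0 t) - dirderiv v F (?q 0 0))) (at 0)"
      unfolding swap by (intro has_vector_derivative_diff dirderiv_along_eq[OF F])
    ultimately show ?thesis
      using fund[OF t] by (auto dest: vector_derivative_unique_at)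
  qed
  \<comment> \<open>Since \<open>main\<close> covers t >= 0 only, the derivative at 0 is taken
    within \<open>{0..1}\<close>, where it is still unique.\<close>
  have "((\<lambda>t. integral {0..t} (\<lambda>\<tau>. dirderiv v (dirderiv u F) (?q 0 \<tau>))) has_vector_derivative
      dirderiv v (dirderiv u F) (?q 0 0)) (at 0 within {0..1})"
    by (rule integral_has_vector_derivative[OF cont]) (auto intro!: continuous_intros)
  then have "((\<lambda>t. dirderiv v F (?q 0 t) - dirderiv v F x) has_vector_derivative
      dirderiv v (dirderiv u F) (?q 0 0)) (at 0 within {0..1})"
    by (rule has_vector_derivative_transform[rotated 2]) (use main in auto)
  moreover have "((\<lambda>t. dirderiv v F (?q 0 t) - dirderiv v F x) has_vector_derivative
      dirderiv u (dirderiv v F) (?q 0 0) - 0) (at 0 within {0..1})"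
    by (intro has_vector_derivative_diff dirderiv_along_eq[OF Fv] has_vector_derivative_const)
  ultimately show ?thesis
    using vector_derivative_unique_within[of "0::real" "{0..1}"]
    by (simp add: trivial_limit_within islimpt_Icc)
qed

section \<open>Inserting vector fields into families of linear maps\<close>

lemma linear_basis_expansion:
  fixes f :: "'a::euclidean_space \<Rightarrow> 'b::real_vector"
  assumes "linear f"
  shows "f v = (\<Sum>e\<in>Basis. (v \<bullet> e) *\<^sub>R f e)"
proof -
  have "f v = f (\<Sum>e\<in>Basis. (v \<bullet> e) *\<^sub>R e)" by (simp add: euclidean_representation)
  then show ?thesis using assms by (simp add: linear_sum linear_scale)
qed

text \<open>Expanding \<open>B y\<close> in the standard basis turns the substitution into a finite
  sum of products of smooth functions.\<close>

lemma smooth_inv_apply: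
  fixes B :: "'a::real_normed_vector \<Rightarrow> 'c::euclidean_space"
  assumes "\<And>b. smooth_inv S (\<lambda>y. T y b)" "\<And>y. linear (T y)" "smooth_inv S B"
  shows "smooth_inv S (\<lambda>y. T y (B y))"
proof -
  have "smooth_inv S (\<lambda>y. \<Sum>e\<in>Basis. (B y \<bullet> e) *\<^sub>R T y e)"
    by (intro smooth_inv_sum smooth_inv_bilinear[OF bounded_bilinear_scaleR]
        smooth_inv_linear[OF bounded_linear_inner_left] assms)
  then show ?thesis by (subst linear_basis_expansion[OF assms(2)])
qed

text \<open>The product rule in the form used throughout: the first term differentiates the family
  with its argument frozen at \<open>B x\<close>, and the second one differentiates the
  argument.\<close>

lemma dirderiv_apply:
  fixes B :: "'a::real_normed_vector \<Rightarrow> 'c::euclidean_space"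
  assumes T: "\<And>b. smooth_inv S (\<lambda>y. T y b)" and lin: "\<And>y. linear (T y)" and B: "smooth_inv S B"
  shows "dirderiv v (\<lambda>y. T y (B y)) x = dirderiv v (\<lambda>y. T y (B x)) x + T x (dirderiv v B x)"
proof -
  have Be: "((\<lambda>y. B y \<bullet> e) has_derivative (\<lambda>v. dirderiv v B x \<bullet> e)) (at x)" for e
    using B by (intro bounded_linear.has_derivative[OF bounded_linear_inner_left] has_derivative_dirderiv) auto
  have Te: "((\<lambda>y. T y e) has_derivative (\<lambda>v. dirderiv v (\<lambda>y. T y e) x)) (at x)" for e
    using T by (intro has_derivative_dirderiv) auto
  have "((\<lambda>y. \<Sum>e\<in>Basis. (B y \<bullet> e) *\<^sub>R T y e) has_derivative
      (\<lambda>v. \<Sum>e\<in>Basis. (B x \<bullet> e) *\<^sub>R dirderiv v (\<lambda>y. T y e) x + (dirderiv v B x \<bullet> e) *\<^sub>R T x e)) (at x)"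
    by (intro has_derivative_sum has_derivative_scaleR Be Te)
  moreover have "((\<lambda>y. \<Sum>e\<in>Basis. (B x \<bullet> e) *\<^sub>R T y e) has_derivative
      (\<lambda>v. \<Sum>e\<in>Basis. (B x \<bullet> e) *\<^sub>R dirderiv v (\<lambda>y. T y e) x)) (at x)"
    by (intro has_derivative_sum has_derivative_scaleR_right Te)
  moreover have "(\<lambda>y. T y (B y)) = (\<lambda>y. \<Sum>e\<in>Basis. (B y \<bullet> e) *\<^sub>R T y e)"
    "(\<lambda>y. T y (B x)) = (\<lambda>y. \<Sum>e\<in>Basis. (B x \<bullet> e) *\<^sub>R T y e)"
    "T x (dirderiv v B x) = (\<Sum>e\<in>Basis. (dirderiv v B x \<bullet> e) *\<^sub>R T x e)"
    by (rule ext linear_basis_expansion[OF lin])+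
  ultimately show ?thesis
    by (simp only: dirderiv_eqI sum.distrib)
qed

section \<open>Integration over the torus\<close>

text \<open>The part of the translated cube that sticks out of the unit cube is moved back by the
  period \<open>b\<close> and fills the gap that the translation left.\<close>

lemma integral_unit_cube_shift:
  fixes f :: "'a::euclidean_space \<Rightarrow> real"
  assumes cont: "continuous_on UNIV f" and per: "\<And>x. f (x + b) = f x"
    and b: "b \<in> Basis" and t: "0 \<le> t" "t \<le> 1"
  shows "integral (cbox 0 One) (\<lambda>x. f (x + t *\<^sub>R b)) = integral (cbox 0 One) f"
proof -
  define c where "c = t *\<^sub>R b"
  have ci: "c \<bullet> b = t" "i \<in> Basis - {b} \<Longrightarrow> c \<bullet> i = 0"
    and bi: "b \<bullet> b = 1" "i \<in> Basis - {b} \<Longrightarrow> b \<bullet> i = 0"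
    and oi: "One \<bullet> b = 1" "i \<in> Basis - {b} \<Longrightarrow> One \<bullet> i = 1" for i
    using b by (auto simp: c_def inner_Basis)
  have int: "f integrable_on cbox u v" for u v
    by (meson cont continuous_on_subset integrable_continuous subset_UNIV)
  have mem: "x \<in> cbox u v \<longleftrightarrow> (u \<bullet> b \<le> x \<bullet> b \<and> x \<bullet> b \<le> v \<bullet> b) \<and>
      (\<forall>i\<in>Basis - {b}. u \<bullet> i \<le> x \<bullet> i \<and> x \<bullet> i \<le> v \<bullet> i)" for x u v :: 'a
    using b unfolding mem_box by blast
  note simps = set_eq_iff Int_iff mem_Collect_eq mem inner_add_left inner_diff_left inner_zero_left
    ci bi oi
  \<comment> \<open>In the direction \<open>b\<close> the translated cube occupies [t, 1 + t] and is
    cut at 1, while the unit cube is cut at t; the pieces \<open>s1\<close> and \<open>s4\<close>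
    coincide, and \<open>s2\<close> is \<open>s3\<close> translated by \<open>b\<close>.\<close>
  have s1: "cbox c (One + c) \<inter> {x. x \<bullet> b \<le> 1} = cbox c One"
    using t by (simp only: simps cong: ball_cong) auto
  have s2: "cbox c (One + c) \<inter> {x. x \<bullet> b \<ge> 1} = cbox b (One + c)"
    using t by (simp only: simps cong: ball_cong) auto
  have s3: "cbox 0 One \<inter> {x. x \<bullet> b \<le> t} = cbox 0 (One + c - b)"
    using t by (simp only: simps cong: ball_cong) auto
  have s4: "cbox 0 One \<inter> {x. x \<bullet> b \<ge> t} = cbox c One"
    using t by (simp only: simps cong: ball_cong) auto
  have "integral (cbox 0 One) (\<lambda>x. f (x + c)) = integral (cbox c (One + c)) f"
    using integral_shift_cbox[of c c "One + c" f] by simp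
  also have "\<dots> = integral (cbox c One) f + integral (cbox b (One + c)) f"
    using integral_split[OF int b, of c "One + c" 1] by (simp add: s1 s2)
  also have "integral (cbox b (One + c)) f = integral (cbox 0 (One + c - b)) f"
    using integral_shift_cbox[of b b "One + c" f] by (simp add: per)
  also have "integral (cbox c One) f + integral (cbox 0 (One + c - b)) f = integral (cbox 0 One) f"
    using integral_split[OF int b, of 0 One t] by (simp add: s3 s4)
  finally show ?thesis by (simp add: c_def)
qed

text \<open>The integral of the translate by \<open>t *\<^sub>R b\<close> does not depend on t;
  differentiate under the integral sign at t = 0.\<close>

lemma integral_unit_cube_derivative:
  fixes f :: "'a::euclidean_space \<Rightarrow> real"
  assumes cont: "continuous_on UNIV f" "continuous_on UNIV f'" and per: "\<And>x. f (x + b) = f x"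
    and deriv: "\<And>x t U. ((\<lambda>t. f (x + t *\<^sub>R b)) has_vector_derivative f' (x + t *\<^sub>R b)) (at t within U)"
    and b: "b \<in> Basis"
  shows "(f' has_integral 0) (cbox 0 One)"
proof -
  have "((\<lambda>t. integral (cbox 0 One) (\<lambda>x. f (x + t *\<^sub>R b))) has_vector_derivative
      integral (cbox 0 One) (\<lambda>x. f' (x + 0 *\<^sub>R b))) (at 0 within {0..1})"
  proof (rule leibniz_rule_vector_derivative[OF deriv])
    show "(\<lambda>x. f (x + t *\<^sub>R b)) integrable_on cbox 0 One" for t
      by (intro integrable_continuous continuous_on_compose2[OF cont(1)]) (auto intro!: continuous_intros)
    show "continuous_on ({0..1} \<times> cbox 0 One) (\<lambda>(t, x). f' (x + t *\<^sub>R b))"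
      unfolding split_beta
      by (intro continuous_on_compose2[OF cont(2)]) (auto intro!: continuous_intros)
  qed auto
  moreover have "((\<lambda>t. integral (cbox 0 One) (\<lambda>x. f (x + t *\<^sub>R b))) has_vector_derivative 0) (at 0 within {0..1})"
    by (rule has_vector_derivative_transform[OF _ _ has_vector_derivative_const[of "integral (cbox 0 One) f"]])
       (auto simp: integral_unit_cube_shift[OF cont(1) per b])
  ultimately have "integral (cbox 0 One) f' = 0"
    using vector_derivative_unique_within[of "0::real" "{0..1}"]
    by (simp add: trivial_limit_within islimpt_Icc)
  moreover have "f' integrable_on cbox 0 One"
    by (meson cont(2) continuous_on_subset integrable_continuous subset_UNIV)
  ultimately show ?thesis by (simp add: has_integral_iff)
qed

section \<open>From the unit cube to a general lattice\<close>

lemma full_lattice_parametrization: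
  fixes L :: "'a::euclidean_space set"
  assumes "full_lattice UNIV L"
  obtains T :: "'a \<Rightarrow> 'a" where "linear T" "surj T" "T ` Basis \<subseteq> L"
proof -
  obtain B where B: "finite B" "independent B" "span B = UNIV"
      and L: "L = {\<Sum>b\<in>B. of_int (c b) *\<^sub>R b | c. True}"
    using assms unfolding full_lattice_def by blast
  have "card B = DIM('a)" by (metis B(2,3) dim_UNIV dim_span_eq_card_independent)
  then obtain \<pi> :: "'a \<Rightarrow> 'a" where \<pi>: "bij_betw \<pi> Basis B"
    using B(1) finite_same_card_bij[of "Basis :: 'a set" B] by auto
  define T where "T x = (\<Sum>e\<in>Basis. (x \<bullet> e) *\<^sub>R \<pi> e)" for x :: 'a
  have lin: "linear T"
    unfolding T_def by (intro linear_compose_sum ballI linearI) (auto simp: inner_simps algebra_simps)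
  have Te: "T e = \<pi> e" if "e \<in> Basis" for e
    using that by (simp add: T_def inner_Basis if_distrib[of "\<lambda>r. r *\<^sub>R _"] cong: if_cong)
  have img: "T ` Basis = B" using \<pi> Te by (auto simp: bij_betw_def)
  have "range T = UNIV" using linear_span_image[OF lin, of Basis] by (simp add: img B(3))
  moreover have "B \<subseteq> L"
  proof
    fix b assume "b \<in> B"
    then have "(\<Sum>x\<in>B. of_int (if x = b then 1 else 0) *\<^sub>R x) = b"
      using B(1) by (simp add: if_distrib[of of_int] if_distrib[of "\<lambda>r. r *\<^sub>R _"] cong: if_cong)
    then show "b \<in> L"
      unfolding L by (intro CollectI exI[of _ "\<lambda>x. if x = b then 1 else 0"]) simp
  qed
  ultimately show ?thesis using that[OF lin] img by simp
qed

text \<open>If \<open>T\<close> maps the standard basis to a lattice basis, then \<open>u \<mapsto> p + T u\<close> maps the unit cube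
  onto a fundamental domain. The base point \<open>p\<close> is kept arbitrary so that conclusions at \<open>p\<close>
  hold at every point.\<close>

definition null :: "('a::euclidean_space \<Rightarrow> 'a) \<Rightarrow> 'a \<Rightarrow> ('a \<Rightarrow> real) \<Rightarrow> bool" where
  "null T p \<phi> \<longleftrightarrow> ((\<lambda>u. \<phi> (p + T u)) has_integral 0) (cbox 0 One)"

lemma null_add: "null T p f \<Longrightarrow> null T p g \<Longrightarrow> null T p (\<lambda>x. f x + g x)"
  unfolding null_def by (drule (1) has_integral_add) simp

lemma null_cmult: "null T p f \<Longrightarrow> null T p (\<lambda>x. c * f x)"
  unfolding null_def by (drule has_integral_mult_right[where c = c]) simp

lemma null_diff: "null T p f \<Longrightarrow> null T p g \<Longrightarrow> null T p (\<lambda>x. f x - g x)"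
  unfolding null_def by (drule (1) has_integral_diff) simp

lemma null_sum: "finite A \<Longrightarrow> (\<And>i. i \<in> A \<Longrightarrow> null T p (f i)) \<Longrightarrow> null T p (\<lambda>x. \<Sum>i\<in>A. f i x)"
  unfolding null_def using has_integral_sum[of A "\<lambda>i u. f i (p + T u)" "\<lambda>_. 0"] by simp

text \<open>Pulled back by \<open>T\<close>, a lattice-periodic function has period 1 in each
  coordinate, so its coordinate derivatives integrate to zero over the cube. As \<open>T\<close> is
  onto, every direction is a combination of the \<open>T b\<close>.\<close>

lemma null_dirderiv:
  fixes \<phi> :: "'a::euclidean_space \<Rightarrow> real"
  assumes \<phi>: "smooth_inv L \<phi>" and T: "linear T" "surj T" "T ` Basis \<subseteq> L"
  shows "null T p (dirderiv v \<phi>)"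
proof -
  obtain u where u: "v = T u" using T(2) by blast
  have "null T p (dirderiv (T b) \<phi>)" if b: "b \<in> Basis" for b
    unfolding null_def
  proof (rule integral_unit_cube_derivative[OF _ _ _ _ b])
    have c: "continuous_on UNIV (\<lambda>u. p + T u)"
      by (intro continuous_on_add continuous_on_const linear_continuous_on T(1)[unfolded linear_conv_bounded_linear])
    show "continuous_on UNIV (\<lambda>u. \<phi> (p + T u))" "continuous_on UNIV (\<lambda>u. dirderiv (T b) \<phi> (p + T u))"
      by (rule continuous_on_compose2[OF smooth_inv_continuous[of L _ UNIV] c], use \<phi> in auto)+
    show "\<phi> (p + T (x + b)) = \<phi> (p + T x)" for x
      using smooth_inv_shift[OF \<phi>, of "T b" "p + T x"] T(3) b
      by (auto simp: linear_add[OF T(1)] add.assoc)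
    show "((\<lambda>t. \<phi> (p + T (x + t *\<^sub>R b))) has_vector_derivative dirderiv (T b) \<phi> (p + T (x + t *\<^sub>R b))) (at t within U)"
      for x t U
      using dirderiv_along_eq[OF \<phi>, of "p + T x" "T b" t U]
      by (simp add: linear_add[OF T(1)] linear_scale[OF T(1)] add.assoc)
  qed
  then have "null T p (\<lambda>x. \<Sum>b\<in>Basis. (u \<bullet> b) * dirderiv (T b) \<phi> x)"
    by (intro null_sum null_cmult) auto
  moreover have "dirderiv v \<phi> x = (\<Sum>b\<in>Basis. (u \<bullet> b) * dirderiv (T b) \<phi> x)" for x
    using linear_basis_expansion[OF linear_compose[OF T(1) linear_dirderiv[OF smooth_inv_differentiable[OF \<phi>]], of x], of u]
    by (simp add: u o_def)
  ultimately show ?thesis by (simp add: null_def)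
qed

text \<open>A continuous nonnegative function with zero integral vanishes on the whole closed cube,
  in particular at its corner 0, which corresponds to \<open>p\<close>.\<close>

lemma null_nonneg_imp_0:
  assumes "null T p \<phi>" "linear T" "continuous_on UNIV \<phi>" "\<And>x. 0 \<le> \<phi> x"
  shows "\<phi> p = 0"
proof -
  have "continuous_on (cbox 0 One) (\<lambda>u. \<phi> (p + T u))"
    by (intro continuous_on_compose2[OF assms(3)] continuous_on_add continuous_on_const
        linear_continuous_on assms(2)[unfolded linear_conv_bounded_linear]) auto
  then have "\<phi> (p + T 0) = 0"
    by (rule has_integral_0_cbox_imp_0) (use assms in \<open>auto simp: null_def box_ne_empty mem_box\<close>)
  then show ?thesis using linear_0[OF assms(2)] by simp
qed

text \<open>The integrand is the divergence of \<open>\<phi> A\<close>, since \<open>A\<close> is constant along \<open>K\<close>.\<close>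

lemma null_dirderiv_field:
  fixes A :: "'a::euclidean_space \<Rightarrow> 'a"
  assumes T: "linear T" "surj T" "T ` Basis \<subseteq> L" and K: "subspace K"
    and A: "smooth_inv (L \<union> K) A" "\<And>x. A x \<in> K" and \<phi>: "smooth_inv L \<phi>"
  shows "null T p (\<lambda>x. dirderiv (A x) \<phi> x)"
proof -
  obtain C where C: "C \<subseteq> K" "pairwise orthogonal C" "\<And>c. c \<in> C \<Longrightarrow> norm c = 1"
      "independent C" "span C = K"
    using orthonormal_basis_subspace[OF K] by metis
  have AL: "smooth_inv L A" using A(1) smooth_inv_mono by blast
  \<comment> \<open>Hence the coefficient \<open>A y \<bullet> c\<close> has zero derivative in the
    direction \<open>c\<close>, and can be moved inside the derivative along
    \<open>c\<close>.\<close>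
  have Ac: "dirderiv c A x = 0" if "c \<in> K" for c x
    using A(1) K that by (intro dirderiv_eq_0_if_invariant) (auto intro!: smooth_inv_shift[OF A(1)] subspace_scale)
  have "dirderiv (A x) \<phi> x = (\<Sum>c\<in>C. dirderiv c (\<lambda>y. (A y \<bullet> c) * \<phi> y) x)" for x
  proof -
    have "dirderiv c (\<lambda>y. (A y \<bullet> c) * \<phi> y) x = (A x \<bullet> c) * dirderiv c \<phi> x" if "c \<in> C" for c
    proof -
      have "smooth_inv L (\<lambda>y. A y \<bullet> c)" by (rule smooth_inv_linear[OF bounded_linear_inner_left AL])
      moreover have "dirderiv c (\<lambda>y. A y \<bullet> c) x = 0"
        using dirderiv_linear[OF bounded_linear_inner_left smooth_inv_differentiable[OF AL], of c c x]
          Ac[of c x] that C(1) by auto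
      ultimately show ?thesis
        using dirderiv_bilinear[OF bounded_bilinear_mult smooth_inv_differentiable smooth_inv_differentiable[OF \<phi>]]
        by auto
    qed
    moreover have "A x = (\<Sum>c\<in>C. (A x \<bullet> c) *\<^sub>R c)"
      using orthonormal_basis_expand[OF C(2,3), of "A x"] A(2)[of x] C(4,5)
      by (simp add: independent_imp_finite)
    then have "dirderiv (A x) \<phi> x = dirderiv (\<Sum>c\<in>C. (A x \<bullet> c) *\<^sub>R c) \<phi> x"
      by (rule arg_cong)
    moreover have "linear (\<lambda>v. dirderiv v \<phi> x)" using \<phi> by (intro linear_dirderiv) auto
    ultimately show ?thesis
      using linear_sum[of "\<lambda>v. dirderiv v \<phi> x" "\<lambda>c. (A x \<bullet> c) *\<^sub>R c" C]
        linear_scale[of "\<lambda>v. dirderiv v \<phi> x"] by simp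
  qed
  moreover have "null T p (\<lambda>x. \<Sum>c\<in>C. dirderiv c (\<lambda>y. (A y \<bullet> c) * \<phi> y) x)"
    by (intro null_sum null_dirderiv[OF _ T] smooth_inv_bilinear[OF bounded_bilinear_mult]
        smooth_inv_linear[OF bounded_linear_inner_left AL] \<phi> independent_imp_finite C(4))
  ultimately show ?thesis by (simp add: null_def)
qed

section \<open>A Bochner type identity\<close>

lemma bounded_linear_blinfun_eval: "bounded_linear (\<lambda>f. blinfun_apply f v)"
  by (rule bounded_bilinear.bounded_linear_left[OF bounded_bilinear_blinfun_apply])

lemma dirderiv_blinfun_eval:
  "smooth_inv S A \<Longrightarrow> dirderiv c (\<lambda>y. blinfun_apply (A y) v) x = blinfun_apply (dirderiv c A x) v"
  by (rule dirderiv_linear[OF bounded_linear_blinfun_eval smooth_inv_differentiable])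

lemma linear_dirderiv_family:
  assumes "\<And>a. smooth_inv S (\<lambda>y. f y a)" "\<And>y. linear (f y)"
  shows "linear (\<lambda>a. dirderiv c (\<lambda>y. f y a) x)"
proof (rule linearI)
  fix a b r
  show "dirderiv c (\<lambda>y. f y (a + b)) x = dirderiv c (\<lambda>y. f y a) x + dirderiv c (\<lambda>y. f y b) x"
    unfolding linear_add[OF assms(2)] by (intro dirderiv_add smooth_inv_differentiable[OF assms(1)])
  show "dirderiv c (\<lambda>y. f y (r *\<^sub>R a)) x = r *\<^sub>R dirderiv c (\<lambda>y. f y a) x"
    unfolding linear_scale[OF assms(2)]
    by (intro dirderiv_linear[OF bounded_linear_scaleR_right] smooth_inv_differentiable[OF assms(1)])
qed

section \<open>Trilinear forms, the exterior derivative of a 2-form, and its (1,2)-component\<close>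

definition trilinear :: "('a::real_vector \<Rightarrow> 'a \<Rightarrow> 'a \<Rightarrow> 'b::real_vector) \<Rightarrow> bool" where
  "trilinear f \<longleftrightarrow>
     (\<forall>b c. linear (\<lambda>a. f a b c)) \<and> (\<forall>a c. linear (\<lambda>b. f a b c)) \<and> (\<forall>a b. linear (\<lambda>c. f a b c))"

lemma smooth_inv_apply3:
  fixes A B C :: "'a::real_normed_vector \<Rightarrow> 'c::euclidean_space"
  assumes f: "\<And>a b c. smooth_inv S (\<lambda>y. f y a b c)" "\<And>y. trilinear (f y)"
    and "smooth_inv S A" "smooth_inv S B" "smooth_inv S C"
  shows "smooth_inv S (\<lambda>y. f y (A y) (B y) (C y))"
proof -
  have "smooth_inv S (\<lambda>y. f y (A y) b c)" for b c
    by (rule smooth_inv_apply[of S "\<lambda>y a. f y a b c"]) (use assms in \<open>auto simp: trilinear_def\<close>)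
  then have "smooth_inv S (\<lambda>y. f y (A y) (B y) c)" for c
    by (rule smooth_inv_apply[of S "\<lambda>y b. f y (A y) b c"]) (use assms in \<open>auto simp: trilinear_def\<close>)
  then show ?thesis
    by (rule smooth_inv_apply[of S "\<lambda>y c. f y (A y) (B y) c"]) (use assms in \<open>auto simp: trilinear_def\<close>)
qed

text \<open>The exterior derivative of the 2-form \<open>w\<close> on constant vector fields;
  \<open>ext_deriv_3\<close> relates it to \<open>ext_deriv\<close>.\<close>

definition d2 :: "('a::real_normed_vector \<Rightarrow> 'a \<Rightarrow> 'a \<Rightarrow> real) \<Rightarrow> 'a \<Rightarrow> 'a \<Rightarrow> 'a \<Rightarrow> 'a \<Rightarrow> real" where
  "d2 w x a b c =
     dirderiv a (\<lambda>y. w y b c) x - dirderiv b (\<lambda>y. w y a c) x + dirderiv c (\<lambda>y. w y a b) x"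

text \<open>Eight times the imaginary part of the \<open>(1,2)\<close>-component of a real 3-form.\<close>

definition im12 :: "('a \<Rightarrow> 'a) \<Rightarrow> ('a \<Rightarrow> 'a \<Rightarrow> 'a \<Rightarrow> real) \<Rightarrow> 'a \<Rightarrow> 'a \<Rightarrow> 'a \<Rightarrow> real" where
  "im12 j \<beta> a b c = \<beta> (j a) b c + \<beta> a (j b) c + \<beta> a b (j c) + 3 * \<beta> (j a) (j b) (j c)"

locale smooth_2form =
  fixes L :: "'a::euclidean_space set" and J :: "'a \<Rightarrow> ('a \<Rightarrow>\<^sub>L 'a)" and w :: "'a \<Rightarrow> 'a \<Rightarrow> 'a \<Rightarrow> real"
  assumes J_smooth_lattice: "smooth_inv L J"
    and JJ: "J x (J x v) = - v"
    and w_smooth: "smooth_inv L (\<lambda>x. w x a b)"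
    and w_linear1: "linear (\<lambda>a. w x a b)"
    and w_linear2: "linear (\<lambda>b. w x a b)"
    and w_skew: "w x a b = - w x b a"
begin

abbreviation "\<beta> \<equiv> d2 w"
abbreviation "\<gamma> x \<equiv> im12 (J x) (\<beta> x)"

lemma smooth_w [intro]:
  assumes "smooth_inv L A" "smooth_inv L B"
  shows "smooth_inv L (\<lambda>y. w y (A y) (B y))"
proof -
  have "smooth_inv L (\<lambda>y. w y (A y) b)" for b
    by (rule smooth_inv_apply[of L "\<lambda>y a. w y a b"]) (use assms w_smooth w_linear1 in auto)
  then show ?thesis
    by (rule smooth_inv_apply[of L "\<lambda>y b. w y (A y) b"]) (use assms w_linear2 in auto)
qed

lemma dirderiv_w:
  assumes A: "smooth_inv L A" and B: "smooth_inv L B"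
  shows "dirderiv c (\<lambda>y. w y (A y) (B y)) x =
    dirderiv c (\<lambda>y. w y (A x) (B x)) x + w x (dirderiv c A x) (B x) + w x (A x) (dirderiv c B x)"
proof -
  have "dirderiv c (\<lambda>y. w y (A y) (B y)) x =
      dirderiv c (\<lambda>y. w y (A y) (B x)) x + w x (A x) (dirderiv c B x)"
    by (rule dirderiv_apply[of L "\<lambda>y b. w y (A y) b"]) (use A B w_linear2 in auto)
  also have "dirderiv c (\<lambda>y. w y (A y) (B x)) x =
      dirderiv c (\<lambda>y. w y (A x) (B x)) x + w x (dirderiv c A x) (B x)"
    by (rule dirderiv_apply[of L "\<lambda>y a. w y a (B x)"]) (use A w_linear1 w_smooth in auto)
  finally show ?thesis by simp
qed

lemma \<beta>_smooth: "smooth_inv L (\<lambda>x. \<beta> x a b c)"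
  unfolding d2_def by (intro smooth_inv_add smooth_inv_diff smooth_inv_dirderiv w_smooth)

lemma \<beta>_trilinear: "trilinear (\<beta> x)"
proof -
  have "linear (\<lambda>v. dirderiv v (\<lambda>y. w y a b) x)" "linear (\<lambda>a. dirderiv v (\<lambda>y. w y a b) x)"
    "linear (\<lambda>b. dirderiv v (\<lambda>y. w y a b) x)" for v a b
    using linear_dirderiv[OF smooth_inv_differentiable[OF w_smooth]]
      linear_dirderiv_family[of L "\<lambda>y a. w y a b"] linear_dirderiv_family[of L "\<lambda>y b. w y a b"]
      w_smooth w_linear1 w_linear2 by auto
  then show ?thesis
    unfolding trilinear_def d2_def by (intro conjI allI linear_compose_add linear_compose_sub) auto
qed

lemma \<beta>_skew: "\<beta> x b a c = - \<beta> x a b c" "\<beta> x a c b = - \<beta> x a b c"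
proof -
  have *: "dirderiv v (\<lambda>y. w y a b) x = - dirderiv v (\<lambda>y. w y b a) x" for v a b
    unfolding w_skew[of _ a b]
    by (intro dirderiv_linear[OF bounded_linear_minus[OF bounded_linear_ident]]
        smooth_inv_differentiable[OF w_smooth])
  show "\<beta> x b a c = - \<beta> x a b c" "\<beta> x a c b = - \<beta> x a b c"
    unfolding d2_def using *[of _ b a] *[of _ c b] by auto
qed

lemma \<beta>_smooth_field [intro]:
  "smooth_inv L A \<Longrightarrow> smooth_inv L B \<Longrightarrow> smooth_inv L C \<Longrightarrow> smooth_inv L (\<lambda>x. \<beta> x (A x) (B x) (C x))"
  by (rule smooth_inv_apply3[OF \<beta>_smooth \<beta>_trilinear])

lemma J_smooth_field [intro]: "smooth_inv L A \<Longrightarrow> smooth_inv L (\<lambda>x. J x (A x))"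
  by (rule smooth_inv_bilinear[OF bounded_bilinear_blinfun_apply J_smooth_lattice])

lemma \<gamma>_smooth: "smooth_inv L (\<lambda>x. \<gamma> x a b c)"
  unfolding im12_def
  by (intro smooth_inv_add smooth_inv_bilinear[OF bounded_bilinear_mult] smooth_inv_const
      \<beta>_smooth_field J_smooth_field)

lemma linear_J: "linear (blinfun_apply (J x))"
  by (rule bounded_linear.linear[OF blinfun.bounded_linear_right])

lemma \<gamma>_trilinear: "trilinear (\<gamma> x)"
proof -
  note l = \<beta>_trilinear[of x, unfolded trilinear_def]
  have "linear (\<lambda>a. \<beta> x (J x a) b c)" "linear (\<lambda>b. \<beta> x a (J x b) c)" "linear (\<lambda>c. \<beta> x a b (J x c))" for a b c
    using linear_compose[OF linear_J, of "\<lambda>a. \<beta> x a b c"] linear_compose[OF linear_J, of "\<lambda>b. \<beta> x a b c"]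
      linear_compose[OF linear_J, of "\<lambda>c. \<beta> x a b c"] l by (auto simp: o_def)
  moreover have "linear (\<lambda>a. 3 * f a)" if "linear f" for f :: "'a \<Rightarrow> real"
    using linear_compose_scale_right[OF that, of 3] by simp
  ultimately show ?thesis
    unfolding trilinear_def im12_def using l
    by (intro conjI allI linear_compose_add) auto
qed

lemma \<gamma>_skew: "\<gamma> x b a c = - \<gamma> x a b c" "\<gamma> x a c b = - \<gamma> x a b c"
  unfolding im12_def
  using \<beta>_skew(1)[of x "J x b" a c] \<beta>_skew(1)[of x b "J x a" c] \<beta>_skew(1)[of x b a "J x c"]
    \<beta>_skew(1)[of x "J x b" "J x a" "J x c"] \<beta>_skew(2)[of x "J x a" c b] \<beta>_skew(2)[of x a "J x c" b]
    \<beta>_skew(2)[of x a c "J x b"] \<beta>_skew(2)[of x "J x a" "J x c" "J x b"]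
  by auto

end

text \<open>The properties of a lifted BSV structure that the integration argument rests on. With
  \<open>w x a b = g (J a) b\<close>, assumption \<open>w_J\<close> says that \<open>w\<close> has
  type (1,1), and \<open>w_pos\<close> is positivity of the metric, because
  \<open>w v (J v) = g v v\<close>.\<close>

locale twisted_torus = smooth_2form L J w
  for L :: "'a::euclidean_space set" and J w +
  fixes H K :: "'a set" and T :: "'a \<Rightarrow> 'a" and J0 :: "'a \<Rightarrow> 'a"
  assumes T: "linear T" "surj T" "T ` Basis \<subseteq> L"
    and K: "subspace K"
    and J_smooth: "smooth_inv (L \<union> K) J"
    and J_K: "k \<in> K \<Longrightarrow> J x k \<in> K"
    and J_H: "h \<in> H \<Longrightarrow> J x h = J0 h" "h \<in> H \<Longrightarrow> J0 h \<in> H"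
    and dJ_K: "dirderiv v J x u \<in> K"
    and holomorphic: "h \<in> H \<Longrightarrow> dirderiv (J0 h) J x = J x o\<^sub>L dirderiv h J x"
    and w_J: "w x (J x a) (J x b) = w x a b"
    and w_pos: "v \<noteq> 0 \<Longrightarrow> w x v (J x v) > 0"
begin

text \<open>Fields tangent to the fibre directions \<open>K\<close> and constant along them, as
  \<open>null_dirderiv_field\<close> requires. The class is stable under \<open>J\<close>, and
  derivatives of \<open>J\<close> applied to constant vectors belong to it.\<close>

definition basic :: "('a \<Rightarrow> 'a) \<Rightarrow> bool" where
  "basic A \<longleftrightarrow> smooth_inv (L \<union> K) A \<and> (\<forall>x. A x \<in> K)"

lemma basic_smooth: "basic A \<Longrightarrow> smooth_inv L A"
  unfolding basic_def using smooth_inv_mono by blast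

lemma basic_const: "k \<in> K \<Longrightarrow> basic (\<lambda>x. k)"
  by (simp add: basic_def)

lemma basic_J: "basic A \<Longrightarrow> basic (\<lambda>x. J x (A x))"
  by (auto simp: basic_def J_K intro: smooth_inv_bilinear[OF bounded_bilinear_blinfun_apply J_smooth])

lemma basic_dJ: "basic (\<lambda>x. dirderiv v J x k)"
  by (auto simp: basic_def dJ_K
      intro: smooth_inv_bilinear[OF bounded_bilinear_blinfun_apply smooth_inv_dirderiv[OF J_smooth]])

text \<open>The direction \<open>A x\<close> lies in \<open>K\<close>, along which \<open>B\<close>
  is constant, so freezing \<open>B\<close> at \<open>x\<close> does not change the
  derivative.\<close>

lemma null_dirderiv_fields:
  assumes A: "basic A" and B: "basic B"
  shows "null T p (\<lambda>x. dirderiv (A x) (\<lambda>y. w y (B x) c) x)"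
proof -
  have "dirderiv (A x) (\<lambda>y. w y (B x) c) x = dirderiv (A x) (\<lambda>y. w y (B y) c) x" for x
  proof -
    have "dirderiv (A x) B x = 0"
      using A B K unfolding basic_def
      by (intro dirderiv_eq_0_if_invariant) (auto intro: smooth_inv_shift subspace_scale)
    then show ?thesis
      using dirderiv_w[OF basic_smooth[OF B] smooth_inv_const, of "A x" c x] linear_0[OF w_linear1]
        linear_0[OF w_linear2] by simp
  qed
  moreover have "null T p (\<lambda>x. dirderiv (A x) (\<lambda>y. w y (B y) c) x)"
    using A smooth_w[OF basic_smooth[OF B] smooth_inv_const] unfolding basic_def
    by (intro null_dirderiv_field[OF T K]) auto
  ultimately show ?thesis by simp
qed

text \<open>Two of the three terms of \<open>\<beta>\<close> differentiate along \<open>K\<close>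
  and integrate to zero; only the derivative along \<open>c\<close> is left.\<close>

lemma null_\<beta>:
  assumes A: "basic A" and B: "basic B"
  shows "null T p (\<lambda>x. \<beta> x (A x) (B x) c - dirderiv c (\<lambda>y. w y (A x) (B x)) x)"
  using null_diff[OF null_dirderiv_fields[OF A B, of p c] null_dirderiv_fields[OF B A, of p c]]
  by (simp add: d2_def)

text \<open>Differentiate \<open>w (J a) (J b) = w a b\<close>. The corrections appear because the
  arguments on the left are frozen at \<open>x\<close>.\<close>

lemma dirderiv_w_J:
  "dirderiv c (\<lambda>y. w y (J x a) (J x b)) x =
    dirderiv c (\<lambda>y. w y a b) x - w x (dirderiv c J x a) (J x b) - w x (J x a) (dirderiv c J x b)"
  using dirderiv_w[OF J_smooth_field J_smooth_field, OF smooth_inv_const smooth_inv_const, of c a b x]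
  by (simp add: w_J dirderiv_blinfun_eval[OF J_smooth])

text \<open>Differentiate the infinitesimal form \<open>w (J a) b + w a (J b) = 0\<close> of the
  type condition.\<close>

lemma dirderiv_w_J':
  "dirderiv c (\<lambda>y. w y (J x a) b) x + dirderiv c (\<lambda>y. w y a (J x b)) x =
    - w x (dirderiv c J x a) b - w x a (dirderiv c J x b)"
proof -
  have "w y (J y a) b + w y a (J y b) = 0" for y
    using w_J[of y a "J y b"] linear_neg[OF w_linear2] by (simp add: JJ)
  then have "dirderiv c (\<lambda>y. w y (J y a) b + w y a (J y b)) x = 0" by simp
  also have "dirderiv c (\<lambda>y. w y (J y a) b + w y a (J y b)) x =
      dirderiv c (\<lambda>y. w y (J y a) b) x + dirderiv c (\<lambda>y. w y a (J y b)) x"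
    by (rule dirderiv_add) (rule smooth_inv_differentiable, rule smooth_w, auto)+
  finally show ?thesis
    using dirderiv_w[OF J_smooth_field smooth_inv_const, OF smooth_inv_const, of c a b x]
      dirderiv_w[OF smooth_inv_const J_smooth_field, OF smooth_inv_const, of c a b x]
      linear_0[OF w_linear1] linear_0[OF w_linear2]
    by (simp add: dirderiv_blinfun_eval[OF J_smooth])
qed

text \<open>Reduces \<open>\<gamma>\<close>, which involves derivatives of \<open>w\<close>, to
  terms that involve derivatives of \<open>J\<close> and \<open>B\<close> only: after
  \<open>null_\<beta>\<close> the derivatives of \<open>w\<close> combine into the derivative of a
  periodic function.\<close>

lemma null_\<gamma>:
  assumes k: "k \<in> K" and B: "basic B" and c: "c \<in> H"
  shows "null T p (\<lambda>x. \<gamma> x k (B x) c + 4 * (w x k (dirderiv (J0 c) B x) +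
    w x (dirderiv c J x k) (B x) + w x k (dirderiv c J x (B x))))"
proof -
  note kb = basic_const[OF k]
  have "null T p (\<lambda>x. \<gamma> x k (B x) c -
      (dirderiv c (\<lambda>y. w y (J x k) (B x)) x + dirderiv c (\<lambda>y. w y k (J x (B x))) x +
       dirderiv (J0 c) (\<lambda>y. w y k (B x)) x + 3 * dirderiv (J0 c) (\<lambda>y. w y (J x k) (J x (B x))) x))"
    using null_add[OF null_add[OF null_add[OF null_\<beta>[OF basic_J[OF kb] B, of p c]
          null_\<beta>[OF kb basic_J[OF B], of p c]] null_\<beta>[OF kb B, of p "J0 c"]]
        null_cmult[OF null_\<beta>[OF basic_J[OF kb] basic_J[OF B], of p "J0 c"], of 3]]
    by (simp add: im12_def J_H(1)[OF c] algebra_simps)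
  \<comment> \<open>The first two terms are handled by \<open>dirderiv_w_J'\<close>. In the last
    two, holomorphy turns the derivative of \<open>J\<close> along \<open>J0 c\<close> into
    \<open>J\<close> times that along \<open>c\<close>, and \<open>w_J\<close> removes this
    \<open>J\<close>. The factor 4 is 1 + 3.\<close>
  moreover have "dirderiv c (\<lambda>y. w y (J x k) (B x)) x + dirderiv c (\<lambda>y. w y k (J x (B x))) x +
       dirderiv (J0 c) (\<lambda>y. w y k (B x)) x + 3 * dirderiv (J0 c) (\<lambda>y. w y (J x k) (J x (B x))) x =
      4 * dirderiv (J0 c) (\<lambda>y. w y k (B y)) x - 4 * (w x k (dirderiv (J0 c) B x) +
    w x (dirderiv c J x k) (B x) + w x k (dirderiv c J x (B x)))" for x
    using dirderiv_w_J'[of c x k "B x"] dirderiv_w_J[of "J0 c" x k "B x"]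
      dirderiv_w[OF smooth_inv_const basic_smooth[OF B], of "J0 c" k x] linear_0[OF w_linear1]
    by (simp add: holomorphic[OF c] w_J)
  ultimately have "null T p (\<lambda>x. \<gamma> x k (B x) c -
      (4 * dirderiv (J0 c) (\<lambda>y. w y k (B y)) x - 4 * (w x k (dirderiv (J0 c) B x) +
    w x (dirderiv c J x k) (B x) + w x k (dirderiv c J x (B x)))))"
    by simp
  from null_add[OF this null_cmult[OF null_dirderiv[OF smooth_w[OF smooth_inv_const basic_smooth[OF B]] T], of p 4 "J0 c" k]]
  show ?thesis by (simp add: algebra_simps)
qed

text \<open>Differentiate \<open>J \<circ> J = - id\<close>.\<close>

lemma dJ_anticommutes: "dirderiv v J x (J x u) = - J x (dirderiv v J x u)"
proof -
  have "J y o\<^sub>L J y = - id_blinfun" for y by (rule blinfun_eqI) (simp add: JJ blinfun.minus_left)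
  then have "dirderiv v (\<lambda>y. J y o\<^sub>L J y) x = 0" by simp
  then have "(J x o\<^sub>L dirderiv v J x) + (dirderiv v J x o\<^sub>L J x) = 0"
    using dirderiv_bilinear[OF bounded_bilinear_blinfun_compose
        smooth_inv_differentiable[OF J_smooth, of x] smooth_inv_differentiable[OF J_smooth, of x], of v] by simp
  then have "blinfun_apply ((J x o\<^sub>L dirderiv v J x) + (dirderiv v J x o\<^sub>L J x)) u = 0" by simp
  then have "J x (dirderiv v J x u) + dirderiv v J x (J x u) = 0"
    by (simp add: blinfun.add_left)
  then show ?thesis by (simp add: add_eq_0_iff)
qed

text \<open>Holomorphic maps to the twistor space are harmonic; the right-hand side is normal to
  the twistor space because it commutes with \<open>J\<close>.\<close>

lemma harmonic:
  assumes h: "h \<in> H"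
  shows "dirderiv (J0 h) (dirderiv (J0 h) J) x u + dirderiv h (dirderiv h J) x u =
    2 *\<^sub>R J x (dirderiv h J x (dirderiv h J x u))"
proof -
  let ?P = "dirderiv h J" and ?Q = "dirderiv (J0 h) J"
  have Q: "?Q = (\<lambda>x. J x o\<^sub>L ?P x)" using holomorphic[OF h] by auto
  have dQ: "dirderiv v ?Q x = (J x o\<^sub>L dirderiv v ?P x) + (dirderiv v J x o\<^sub>L ?P x)" for v
    unfolding Q
    by (rule dirderiv_bilinear[OF bounded_bilinear_blinfun_compose smooth_inv_differentiable smooth_inv_differentiable])
       (use J_smooth in auto)
  \<comment> \<open>Exchanging the mixed derivatives allows holomorphy to be used a second time: the
    second derivative along \<open>J0 h\<close> becomes minus the one along \<open>h\<close> plus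
    two copies of \<open>J P P\<close>.\<close>
  have "dirderiv (J0 h) ?P x = dirderiv h ?Q x" by (rule dirderiv_commute[OF J_smooth])
  then show ?thesis
    by (simp add: dQ holomorphic[OF h] blinfun.add_left blinfun.add_right JJ scaleR_2)
qed

text \<open>Hypothesis \<open>closed\<close> is the vanishing of the exterior derivative of
  \<open>\<gamma>\<close> on the vectors k, J k, h, J h, all frozen at \<open>x\<close>. Integrating
  it leaves a nonnegative integrand, which must vanish at the arbitrary base point
  \<open>p\<close>.\<close>

lemma dJ_vanishes:
  assumes k: "k \<in> K" and h: "h \<in> H"
    and closed: "\<And>x. dirderiv k (\<lambda>y. \<gamma> y (J x k) h (J0 h)) x - dirderiv (J x k) (\<lambda>y. \<gamma> y k h (J0 h)) x
      + dirderiv h (\<lambda>y. \<gamma> y k (J x k) (J0 h)) x - dirderiv (J0 h) (\<lambda>y. \<gamma> y k (J x k) h) x = 0"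
  shows "dirderiv h J p k = 0"
proof -
  define P where "P = dirderiv h J"
  define Q where "Q = dirderiv (J0 h) J"
  note kb = basic_const[OF k]
  note Jk = basic_J[OF kb]
  have QP: "Q x u = J x (P x u)" for x u by (simp add: P_def Q_def holomorphic[OF h])
  have leib: "dirderiv v (\<lambda>y. \<gamma> y a (J x k) b) x =
      dirderiv v (\<lambda>y. \<gamma> y a (J y k) b) x - \<gamma> x a (dirderiv v J x k) b"
    "smooth_inv L (\<lambda>y. \<gamma> y a (J y k) b)" for v a b x
    using dirderiv_apply[of L "\<lambda>y z. \<gamma> y a z b" "\<lambda>y. J y k" v x] smooth_inv_apply[of L "\<lambda>y z. \<gamma> y a z b" "\<lambda>y. J y k"]
      \<gamma>_smooth \<gamma>_trilinear basic_smooth[OF Jk]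
    by (auto simp: dirderiv_blinfun_eval[OF J_smooth] trilinear_def)
  have dk: "dirderiv k J x k = 0" for x
  proof -
    have "dirderiv k J x = 0"
      using K k by (intro dirderiv_eq_0_if_invariant) (auto intro: smooth_inv_shift[OF J_smooth] subspace_scale J_smooth)
    then show ?thesis by simp
  qed
  have t1: "null T p (\<lambda>x. dirderiv k (\<lambda>y. \<gamma> y (J x k) h (J0 h)) x)"
  proof -
    \<comment> \<open>Skewness moves \<open>J x k\<close> to the middle slot, where
      \<open>leib\<close> applies; its correction vanishes by \<open>dk\<close>.\<close>
    have "dirderiv k (\<lambda>y. \<gamma> y (J x k) h (J0 h)) x = - dirderiv k (\<lambda>y. \<gamma> y h (J y k) (J0 h)) x" for x
    proof -
      have "dirderiv k (\<lambda>y. \<gamma> y (J x k) h (J0 h)) x = - dirderiv k (\<lambda>y. \<gamma> y h (J x k) (J0 h)) x"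
        unfolding \<gamma>_skew(1)[of _ "J x k" h]
        by (intro dirderiv_linear[OF bounded_linear_minus[OF bounded_linear_ident]] smooth_inv_differentiable[OF \<gamma>_smooth])
      then show ?thesis
        using linear_0[of "\<lambda>b. \<gamma> x h b (J0 h)"] \<gamma>_trilinear[of x] by (simp add: leib dk trilinear_def)
    qed
    then show ?thesis
      using null_cmult[OF null_dirderiv[OF leib(2) T], of p "-1" k] by simp
  qed
  have t2: "null T p (\<lambda>x. dirderiv (J x k) (\<lambda>y. \<gamma> y k h (J0 h)) x)"
    using Jk \<gamma>_smooth by (intro null_dirderiv_field[OF T K]) (auto simp: basic_def)
  have t34: "null T p (\<lambda>x. dirderiv v (\<lambda>y. \<gamma> y k (J x k) b) x + \<gamma> x k (dirderiv v J x k) b)" for v b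
    using null_dirderiv[OF leib(2) T, of p v k b] by (simp add: leib)
  \<comment> \<open>The terms of \<open>closed\<close> along \<open>K\<close> are null, and
    integrating the two along \<open>H\<close> by parts leaves \<open>\<gamma>\<close>
    itself.\<close>
  have "null T p (\<lambda>x. \<gamma> x k (Q x k) h - \<gamma> x k (P x k) (J0 h))"
  proof -
    have "null T p (\<lambda>x. \<gamma> x k (Q x k) h - \<gamma> x k (P x k) (J0 h) -
       (dirderiv k (\<lambda>y. \<gamma> y (J x k) h (J0 h)) x - dirderiv (J x k) (\<lambda>y. \<gamma> y k h (J0 h)) x
      + dirderiv h (\<lambda>y. \<gamma> y k (J x k) (J0 h)) x - dirderiv (J0 h) (\<lambda>y. \<gamma> y k (J x k) h) x))"
      using null_add[OF null_diff[OF t2 t1] null_diff[OF t34[of "J0 h" h] t34[of h "J0 h"]]]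
      unfolding P_def Q_def by (simp add: algebra_simps)
    then show ?thesis by (simp only: closed diff_zero)
  qed
  \<comment> \<open>Here \<open>null_\<gamma>\<close> is used with c = J0 h and the field
    \<open>P k\<close>; since J0 (J0 h) = - h, the derivative of that field is taken along -
    h.\<close>
  moreover have "null T p (\<lambda>x. \<gamma> x k (P x k) (J0 h) + 4 * (- w x k (dirderiv h P x k) +
    w x (Q x k) (P x k) + w x k (Q x (P x k))))"
  proof -
    have "J0 (J0 h) = - h" using JJ J_H h by metis
    then have "dirderiv (J0 (J0 h)) (\<lambda>x. P x k) x = - dirderiv h P x k" for x
      using dirderiv_blinfun_eval[of L P] linear_neg[OF linear_dirderiv[of P x], of h] J_smooth_lattice
      unfolding P_def
      by (metis smooth_inv_dirderiv smooth_inv_differentiable blinfun.minus_left)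
    then show ?thesis
      using null_\<gamma>[OF k basic_dJ J_H(2)[OF h], of p h k] linear_neg[OF w_linear2]
      by (simp add: P_def Q_def)
  qed
  moreover have "null T p (\<lambda>x. \<gamma> x k (Q x k) h + 4 * (w x k (dirderiv (J0 h) Q x k) +
    w x (P x k) (Q x k) + w x k (P x (Q x k))))"
  proof -
    have "dirderiv (J0 h) (\<lambda>x. Q x k) x = dirderiv (J0 h) Q x k" for x
      unfolding Q_def by (rule dirderiv_blinfun_eval[OF smooth_inv_dirderiv[OF J_smooth_lattice]])
    then show ?thesis
      using null_\<gamma>[OF k basic_dJ h, of p "J0 h" k] by (simp add: P_def Q_def)
  qed
  ultimately have N: "null T p (\<lambda>x. (\<gamma> x k (Q x k) h + 4 * (w x k (dirderiv (J0 h) Q x k) +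
    w x (P x k) (Q x k) + w x k (P x (Q x k)))) - (\<gamma> x k (P x k) (J0 h) + 4 * (- w x k (dirderiv h P x k) +
    w x (Q x k) (P x k) + w x k (Q x (P x k)))) - (\<gamma> x k (Q x k) h - \<gamma> x k (P x k) (J0 h)))"
    by (intro null_diff[OF null_diff])
  have e1: "w x k (dirderiv (J0 h) Q x k) + w x k (dirderiv h P x k) = 2 * w x k (J x (P x (P x k)))" for x
    using harmonic[OF h, of x k] linear_add[OF w_linear2, of x k] linear_scale[OF w_linear2, of x k 2]
    unfolding P_def Q_def by (metis real_scaleR_def)
  have e2: "w x k (P x (Q x k)) = - w x k (J x (P x (P x k)))" for x
    unfolding QP using dJ_anticommutes[of h x] linear_neg[OF w_linear2] by (simp add: P_def)
  have e3: "w x (J x (P x k)) (P x k) = - w x (P x k) (J x (P x k))" for x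
    by (rule w_skew)
  \<comment> \<open>All terms with \<open>\<gamma>\<close> cancel. The quantity
    \<open>w k (J P P k)\<close> occurs with coefficients 2, -1, -1 by \<open>e1\<close>,
    \<open>e2\<close> and Q = J P, so only two equal multiples of \<open>w (P k) (J P k)\<close>
    remain.\<close>
  have "null T p (\<lambda>x. 8 * w x (P x k) (J x (P x k)))"
  proof (rule back_subst[of "null T p", OF N], rule ext)
    fix x
    show "(\<gamma> x k (Q x k) h + 4 * (w x k (dirderiv (J0 h) Q x k) +
      w x (P x k) (Q x k) + w x k (P x (Q x k)))) - (\<gamma> x k (P x k) (J0 h) + 4 * (- w x k (dirderiv h P x k) +
      w x (Q x k) (P x k) + w x k (Q x (P x k)))) - (\<gamma> x k (Q x k) h - \<gamma> x k (P x k) (J0 h)) =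
      8 * w x (P x k) (J x (P x k))"
      using e1[of x] e2[of x] e3[of x] unfolding QP by argo
  qed
  then have "null T p (\<lambda>x. w x (P x k) (J x (P x k)))"
    using null_cmult[of T p _ "1/8"] by fastforce
  moreover have "smooth_inv L (\<lambda>x. w x (P x k) (J x (P x k)))"
    unfolding P_def using basic_dJ basic_smooth basic_J by (intro smooth_w) blast+
  moreover have "0 \<le> w x v (J x v)" for x v
    using w_pos[of v x] linear_0[OF w_linear1] by (cases "v = 0") auto
  ultimately have "w p (P p k) (J p (P p k)) = 0"
    by (intro null_nonneg_imp_0[OF _ T(1) smooth_inv_continuous]) auto
  then show ?thesis
    using w_pos[of "P p k" p] unfolding P_def by force
qed

end

section \<open>Evaluation of the type components\<close>

lemma subsets_card_1: "{S. S \<subseteq> {..<3::nat} \<and> card S = 1} = {{0}, {1}, {2}}"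
  by (auto simp: card_1_singleton_iff)

lemma subsets_card_2:
  "{S. S \<subseteq> {..<4::nat} \<and> card S = 2} = {{0,1}, {0,2}, {0,3}, {1,2}, {1,3}, {2,3}}"
proof (intro equalityI subsetI)
  fix S :: "nat set" assume S: "S \<in> {S. S \<subseteq> {..<4} \<and> card S = 2}"
  then obtain a b where ab: "S = {a, b}" "a \<noteq> b" by (auto simp: card_2_iff)
  then have "a \<in> {0,1,2,3}" "b \<in> {0,1,2,3}" using S by auto
  then show "S \<in> {{0,1}, {0,2}, {0,3}, {1,2}, {1,3}, {2,3}}"
    unfolding ab(1) using ab(2) by (elim insertE emptyE) (simp_all add: insert_commute)
qed (elim insertE emptyE, simp_all)

text \<open>The counterpart of \<open>im12\<close>: eight times the real part of the
  (1,2)-component.\<close>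

definition re12 :: "('a \<Rightarrow> 'a) \<Rightarrow> ('a \<Rightarrow> 'a \<Rightarrow> 'a \<Rightarrow> real) \<Rightarrow> 'a \<Rightarrow> 'a \<Rightarrow> 'a \<Rightarrow> real" where
  "re12 j \<beta> a b c = 3 * \<beta> a b c + \<beta> (j a) (j b) c + \<beta> (j a) b (j c) + \<beta> a (j b) (j c)"

text \<open>The (1,0)-argument contributes -i j and the other two +i j. Summing over the position of
  the former gives coefficient 3 to the terms with no or three factors j and coefficient 1 to the
  others; the 8 collects three factors 1/2.\<close>

lemma type_part_1_2:
  assumes \<alpha>: "\<And>a b c. \<alpha> [a, b, c] = of_real (\<beta> a b c)" and \<beta>: "trilinear \<beta>"
  shows "type_part j 1 2 \<alpha> [a, b, c] =
    (of_real (re12 (blinfun_apply j) \<beta> a b c) + \<i> * of_real (im12 (blinfun_apply j) \<beta> a b c)) / 8"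
proof -
  note \<beta>' = \<beta>[unfolded trilinear_def]
  have s: "\<beta> (r *\<^sub>R a) b c = r * \<beta> a b c" "\<beta> a (r *\<^sub>R b) c = r * \<beta> a b c" "\<beta> a b (r *\<^sub>R c) = r * \<beta> a b c"
    "\<beta> (- a) b c = - \<beta> a b c" "\<beta> a (- b) c = - \<beta> a b c" "\<beta> a b (- c) = - \<beta> a b c" for r a b c
    using linear_scale[of "\<lambda>a. \<beta> a b c"] linear_scale[of "\<lambda>b. \<beta> a b c"] linear_scale[of "\<lambda>c. \<beta> a b c"]
      linear_neg[of "\<lambda>a. \<beta> a b c"] linear_neg[of "\<lambda>b. \<beta> a b c"] linear_neg[of "\<lambda>c. \<beta> a b c"] \<beta>' by auto
  have "type_part j 1 2 \<alpha> [a, b, c] = (\<Sum>S\<in>{{0}, {1}, {2::nat}}. complexify \<alpha>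
      (map (\<lambda>i. if i \<in> S then part10 j ([a, b, c] ! i) else part01 j ([a, b, c] ! i)) [0..<3]))"
  proof -
    have "(1::nat) + 2 = 3" "length [a, b, c] = 3" by simp_all
    then show ?thesis by (simp only: type_part_def subsets_card_1 refl if_True)
  qed
  also have "\<dots> = (of_real (re12 (blinfun_apply j) \<beta> a b c) + \<i> * of_real (im12 (blinfun_apply j) \<beta> a b c)) / 8"
    by (simp add: upt_rec part10_def part01_def \<alpha> s re12_def im12_def complex_eq_iff)
  finally show ?thesis .
qed

text \<open>The 4-vector \<open>k \<and> j k \<and> h \<and> j h\<close> is of type \<open>(2,2)\<close>.\<close>

lemma type_part_2_2:
  assumes \<alpha>: "\<And>a b c d. \<alpha> [a, b, c, d] = A a b c d"
    and lin: "\<And>a. trilinear (A a)" "\<And>b c d. linear (\<lambda>a. A a b c d)"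
    and skew: "\<And>a b c d. A b a c d = - A a b c d" "\<And>a b c d. A a b d c = - A a b c d"
    and j: "\<And>v. blinfun_apply j (blinfun_apply j v) = - v"
  shows "type_part j 2 2 \<alpha> [k, blinfun_apply j k, h, blinfun_apply j h] = A k (blinfun_apply j k) h (blinfun_apply j h)"
proof -
  note lin' = lin(1)[unfolded trilinear_def]
  have s: "A (r *\<^sub>R a) b c d = r * A a b c d" "A a (r *\<^sub>R b) c d = r * A a b c d"
    "A a b (r *\<^sub>R c) d = r * A a b c d" "A a b c (r *\<^sub>R d) = r * A a b c d"
    "A (- a) b c d = - A a b c d" "A a (- b) c d = - A a b c d"
    "A a b (- c) d = - A a b c d" "A a b c (- d) = - A a b c d" for r a b c d
    using linear_scale[of "\<lambda>a. A a b c d"] linear_scale[of "\<lambda>b. A a b c d"]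
      linear_scale[of "\<lambda>c. A a b c d"] linear_scale[of "\<lambda>d. A a b c d"]
      linear_neg[of "\<lambda>a. A a b c d"] linear_neg[of "\<lambda>b. A a b c d"]
      linear_neg[of "\<lambda>c. A a b c d"] linear_neg[of "\<lambda>d. A a b c d"] lin' lin(2)
    by (auto simp: scaleR_conv_of_real)
  have z: "A a a c d = 0" "A a b c c = 0" for a b c d
    using skew(1)[of a a c d] skew(2)[of a b c c] by (simp_all add: eq_neg_iff_add_eq_0 flip: mult_2)
  \<comment> \<open>Oriented instances of skewness, which bring the surviving terms into the order
    k, j k, h, j h.\<close>
  have k: "A (blinfun_apply j k) k c d = - A k (blinfun_apply j k) c d"
    "A a b (blinfun_apply j h) h = - A a b h (blinfun_apply j h)" for a b c d
    by (rule skew)+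
  have "type_part j 2 2 \<alpha> [k, blinfun_apply j k, h, blinfun_apply j h] =
      (\<Sum>S\<in>{{0,1}, {0,2}, {0,3}, {1,2}, {1,3}, {2,3::nat}}. complexify \<alpha>
      (map (\<lambda>i. if i \<in> S then part10 j ([k, blinfun_apply j k, h, blinfun_apply j h] ! i)
        else part01 j ([k, blinfun_apply j k, h, blinfun_apply j h] ! i)) [0..<4]))"
  proof -
    have "(2::nat) + 2 = 4" "length [k, blinfun_apply j k, h, blinfun_apply j h] = 4" by simp_all
    then show ?thesis by (simp only: type_part_def subsets_card_2 refl if_True)
  qed
  also have "\<dots> = A k (blinfun_apply j k) h (blinfun_apply j h)"
    by (simp add: doubleton_eq_iff upt_rec part10_def part01_def \<alpha> s j z k complex_eq_iff)
  finally show ?thesis .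
qed

text \<open>The exterior derivative of a 3-form on constant fields. The general value type covers
  both the complex form \<open>\<psi>\<close> and the real form \<open>\<gamma>\<close>.\<close>

definition d3 :: "('a::real_normed_vector \<Rightarrow> 'a \<Rightarrow> 'a \<Rightarrow> 'a \<Rightarrow> 'b::real_normed_vector) \<Rightarrow>
    'a \<Rightarrow> 'a \<Rightarrow> 'a \<Rightarrow> 'a \<Rightarrow> 'a \<Rightarrow> 'b" where
  "d3 \<psi> x a b c d = dirderiv a (\<lambda>y. \<psi> y b c d) x - dirderiv b (\<lambda>y. \<psi> y a c d) x
     + dirderiv c (\<lambda>y. \<psi> y a b d) x - dirderiv d (\<lambda>y. \<psi> y a b c) x"

lemma
  assumes sm: "\<And>a b c. smooth_inv S (\<lambda>y. \<psi> y a b c)" and lin: "\<And>y. trilinear (\<psi> y)"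
    and skew: "\<And>y a b c. \<psi> y b a c = - \<psi> y a b c" "\<And>y a b c. \<psi> y a c b = - \<psi> y a b c"
  shows d3_trilinear: "trilinear (d3 \<psi> x a)"
    and d3_linear: "linear (\<lambda>a. d3 \<psi> x a b c d)"
    and d3_skew: "d3 \<psi> x b a c d = - d3 \<psi> x a b c d" "d3 \<psi> x a b d c = - d3 \<psi> x a b c d"
proof -
  have 0: "linear (\<lambda>v. dirderiv v (\<lambda>y. \<psi> y a b c) x)" for a b c
    by (rule linear_dirderiv[OF smooth_inv_differentiable[OF sm]])
  have 1: "linear (\<lambda>a. dirderiv v (\<lambda>y. \<psi> y a b c) x)" for v b c
    by (rule linear_dirderiv_family[of S "\<lambda>y a. \<psi> y a b c"]) (use sm lin in \<open>auto simp: trilinear_def\<close>)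
  have 2: "linear (\<lambda>b. dirderiv v (\<lambda>y. \<psi> y a b c) x)" for v a c
    by (rule linear_dirderiv_family[of S "\<lambda>y b. \<psi> y a b c"]) (use sm lin in \<open>auto simp: trilinear_def\<close>)
  have 3: "linear (\<lambda>c. dirderiv v (\<lambda>y. \<psi> y a b c) x)" for v a b
    by (rule linear_dirderiv_family[of S "\<lambda>y c. \<psi> y a b c"]) (use sm lin in \<open>auto simp: trilinear_def\<close>)
  show "trilinear (d3 \<psi> x a)" "linear (\<lambda>a. d3 \<psi> x a b c d)" for a
    unfolding trilinear_def d3_def
    by (intro conjI allI linear_compose_add linear_compose_sub 0 1 2 3)+
  have m: "dirderiv v (\<lambda>y. - \<psi> y a b c) x = - dirderiv v (\<lambda>y. \<psi> y a b c) x" for v a b c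
    by (rule dirderiv_linear[OF bounded_linear_minus[OF bounded_linear_ident] smooth_inv_differentiable[OF sm]])
  show "d3 \<psi> x b a c d = - d3 \<psi> x a b c d" "d3 \<psi> x a b d c = - d3 \<psi> x a b c d"
    unfolding d3_def using m[of _ a b] m[of _ _ c d] m[of _ _ c d]
      skew(1)[of _ b a] skew(2)[of _ _ d c] by simp_all
qed

lemma ext_deriv_3:
  assumes "\<And>y a b. \<alpha> y [a, b] = of_real (w y a b)" "\<And>a b. smooth_inv S (\<lambda>y. w y a b)"
  shows "ext_deriv \<alpha> x [a, b, c] = of_real (d2 w x a b c)"
proof -
  have "frechet_derivative (\<lambda>y. of_real (w y a b) :: complex) (at x) v = of_real (dirderiv v (\<lambda>y. w y a b) x)" for v a b
    using dirderiv_linear[OF bounded_linear_of_real smooth_inv_differentiable[OF assms(2)]]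
    by (simp add: dirderiv_def)
  then show ?thesis
    by (simp add: ext_deriv_def d2_def numeral_3_eq_3 assms(1))
qed

lemma ext_deriv_4:
  assumes "\<And>y a b c. \<alpha> y [a, b, c] = \<psi> y a b c"
  shows "ext_deriv \<alpha> x [a, b, c, d] = d3 \<psi> x a b c d"
  by (simp add: ext_deriv_def d3_def dirderiv_def eval_nat_numeral assms)

context smooth_2form
begin

abbreviation "\<rho> x \<equiv> re12 (J x) (\<beta> x)"

lemma \<rho>_smooth: "smooth_inv L (\<lambda>x. \<rho> x a b c)"
  unfolding re12_def
  by (intro smooth_inv_add smooth_inv_bilinear[OF bounded_bilinear_mult] smooth_inv_const
      \<beta>_smooth_field J_smooth_field)

lemma \<rho>_trilinear: "trilinear (\<rho> x)"
proof -
  note l = \<beta>_trilinear[of x, unfolded trilinear_def]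
  have "linear (\<lambda>a. \<beta> x (J x a) b c)" "linear (\<lambda>b. \<beta> x a (J x b) c)" "linear (\<lambda>c. \<beta> x a b (J x c))" for a b c
    using linear_compose[OF linear_J, of "\<lambda>a. \<beta> x a b c"] linear_compose[OF linear_J, of "\<lambda>b. \<beta> x a b c"]
      linear_compose[OF linear_J, of "\<lambda>c. \<beta> x a b c"] l by (auto simp: o_def)
  moreover have "linear (\<lambda>a. 3 * f a)" if "linear f" for f :: "'a \<Rightarrow> real"
    using linear_compose_scale_right[OF that, of 3] by simp
  ultimately show ?thesis
    unfolding trilinear_def re12_def using l
    by (intro conjI allI linear_compose_add) auto
qed

lemma \<rho>_skew: "\<rho> x b a c = - \<rho> x a b c" "\<rho> x a c b = - \<rho> x a b c"
  unfolding re12_def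
  using \<beta>_skew(1)[of x b a c] \<beta>_skew(1)[of x "J x b" "J x a" c] \<beta>_skew(1)[of x "J x b" a "J x c"]
    \<beta>_skew(1)[of x b "J x a" "J x c"] \<beta>_skew(2)[of x a c b] \<beta>_skew(2)[of x "J x a" "J x c" b]
    \<beta>_skew(2)[of x a "J x c" "J x b"] \<beta>_skew(2)[of x "J x a" c "J x b"]
  by auto

text \<open>By \<open>type_part_1_2\<close>, this is the (1,2)-component of the exterior derivative
  of \<open>w\<close>.\<close>

definition \<psi> :: "'a \<Rightarrow> 'a \<Rightarrow> 'a \<Rightarrow> 'a \<Rightarrow> complex" where
  "\<psi> x a b c = (of_real (\<rho> x a b c) + \<i> * of_real (\<gamma> x a b c)) / 8"

lemma \<psi>_smooth: "smooth_inv L (\<lambda>x. \<psi> x a b c)"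
  unfolding \<psi>_def divide_inverse
  by (intro smooth_inv_add smooth_inv_bilinear[OF bounded_bilinear_mult] smooth_inv_const
      smooth_inv_linear[OF bounded_linear_of_real] \<rho>_smooth \<gamma>_smooth)

lemma \<psi>_trilinear: "trilinear (\<psi> x)"
proof -
  have "linear (\<lambda>a. (of_real (f a) + \<i> * of_real (g a)) / 8)" if "linear f" "linear g" for f g :: "'a \<Rightarrow> real"
    by (rule linearI) (simp_all add: linear_add[OF that(1)] linear_add[OF that(2)] linear_scale[OF that(1)]
        linear_scale[OF that(2)] complex_eq_iff add_divide_distrib)
  then show ?thesis
    using \<rho>_trilinear[of x] \<gamma>_trilinear[of x] unfolding trilinear_def \<psi>_def by blast
qed

lemma \<psi>_skew: "\<psi> x b a c = - \<psi> x a b c" "\<psi> x a c b = - \<psi> x a b c"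
  unfolding \<psi>_def \<rho>_skew(1)[of x b a] \<gamma>_skew(1)[of x b a] \<rho>_skew(2)[of x a c b] \<gamma>_skew(2)[of x a c b]
  by (simp_all add: complex_eq_iff)

text \<open>On a 4-vector of type (2,2) the type projection in \<open>del\<close> changes nothing,
  so the full exterior derivative of \<open>\<psi>\<close> vanishes there; its imaginary part is
  that of \<open>\<gamma>\<close> up to the factor 8.\<close>

lemma closed_if_pluriclosed:
  assumes \<alpha>: "\<And>y a b. \<alpha> y [a, b] = of_real (w y a b)"
    and zero: "del J 1 2 (delbar J 1 1 \<alpha>) x [k, J x k, h, J x h] = 0"
  shows "d3 (\<lambda>x. \<gamma> x) x k (J x k) h (J x h) = 0"
proof -
  have "delbar J 1 1 \<alpha> y [a, b, c] = \<psi> y a b c" for y a b c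
    unfolding delbar_def \<psi>_def Suc_1
    by (rule type_part_1_2[OF ext_deriv_3[of \<alpha> w L, OF \<alpha> w_smooth] \<beta>_trilinear])
  then have "type_part (J x) 2 2 (ext_deriv (delbar J 1 1 \<alpha>) x) [k, J x k, h, J x h] =
      d3 \<psi> x k (J x k) h (J x h)"
    by (intro type_part_2_2 ext_deriv_4 d3_trilinear[OF \<psi>_smooth] d3_linear[OF \<psi>_smooth]
        d3_skew[OF \<psi>_smooth] \<psi>_trilinear \<psi>_skew JJ)
  then have "Im (d3 \<psi> x k (J x k) h (J x h)) = 0"
    using zero by (simp add: del_def numeral_2_eq_2)
  moreover have "8 * Im (dirderiv v (\<lambda>y. \<psi> y a b c) x) = dirderiv v (\<lambda>y. \<gamma> y a b c) x" for v a b c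
  proof -
    have "Im (dirderiv v (\<lambda>y. \<psi> y a b c) x) = dirderiv v (\<lambda>y. Im (\<psi> y a b c)) x"
      by (rule dirderiv_linear[OF bounded_linear_Im smooth_inv_differentiable[OF \<psi>_smooth], symmetric])
    moreover have "dirderiv v (\<lambda>y. 8 * Im (\<psi> y a b c)) x = 8 * dirderiv v (\<lambda>y. Im (\<psi> y a b c)) x"
      by (rule dirderiv_linear[OF bounded_linear_mult_right smooth_inv_differentiable[OF
              smooth_inv_linear[OF bounded_linear_Im \<psi>_smooth]]])
    ultimately show ?thesis by (simp add: \<psi>_def)
  qed
  ultimately show ?thesis
    unfolding d3_def by (simp add: algebra_simps flip: \<open>\<And>v a b c. _ = dirderiv v (\<lambda>y. \<gamma> y a b c) x\<close>)
qed

end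

section \<open>Affine BSV tori\<close>

lemma orth_decomp_cases:
  assumes "orth_decomp H K"
  obtains h k where "h \<in> H" "k \<in> K" "x = h + k"
  using assms unfolding orth_decomp_def by blast

lemma orth_proj_decomp:
  assumes HK: "orth_decomp H K" and h: "h \<in> H" and k: "k \<in> K"
  shows "orth_proj H (h + k) = h"
  unfolding orth_proj_def
proof (rule the_equality)
  have Hk: "w \<bullet> k = 0" if "w \<in> H" for w
    using HK k that by (auto simp: orth_decomp_def orthogonal_def)
  show "h \<in> H \<and> (\<forall>w\<in>H. orthogonal (h + k - h) w)"
    using h Hk by (simp add: orthogonal_def inner_commute)
  fix y assume y: "y \<in> H \<and> (\<forall>w\<in>H. orthogonal (h + k - y) w)"
  then have "h - y \<in> H" using HK h by (auto simp: orth_decomp_def subspace_diff)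
  then have "(h + k - y) \<bullet> (h - y) = 0" "k \<bullet> (h - y) = 0"
    using y Hk[of "h - y"] by (auto simp: orthogonal_def inner_commute[of k])
  then have "(h - y) \<bullet> (h - y) = 0" by (simp add: inner_simps)
  then show "y = h" by simp
qed

lemma lcoset_shift:
  assumes L: "full_lattice W L" and l: "l \<in> L"
  shows "lcoset L (x + l) = lcoset L x"
proof -
  obtain B where L: "L = {\<Sum>b\<in>B. of_int (c b) *\<^sub>R b | c. True}"
    using L unfolding full_lattice_def by blast
  have add: "u + v \<in> L" and diff: "u - v \<in> L" if "u \<in> L" "v \<in> L" for u v
  proof -
    obtain c d where "u = (\<Sum>b\<in>B. of_int (c b) *\<^sub>R b)" "v = (\<Sum>b\<in>B. of_int (d b) *\<^sub>R b)"
      using \<open>u \<in> L\<close> \<open>v \<in> L\<close> unfolding L by blast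
    then have "u + v = (\<Sum>b\<in>B. of_int (c b + d b) *\<^sub>R b)" and "u - v = (\<Sum>b\<in>B. of_int (c b - d b) *\<^sub>R b)"
      by (simp_all add: sum.distrib sum_subtractf scaleR_add_left scaleR_diff_left)
    then show "u + v \<in> L" and "u - v \<in> L"
      unfolding L
      by - (rule CollectI, rule exI[of _ "\<lambda>b. c b + d b"], rule conjI[OF _ TrueI], assumption,
        rule CollectI, rule exI[of _ "\<lambda>b. c b - d b"], rule conjI[OF _ TrueI], assumption)
  qed
  have "x + l + m \<in> (\<lambda>m. x + m) ` L" if "m \<in> L" for m
    using add[OF l that] by (auto simp: add.assoc)
  moreover have "x + m \<in> (\<lambda>m. x + l + m) ` L" if "m \<in> L" for m
    using diff[OF that l] by (intro image_eqI[of _ _ "m - l"]) auto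
  ultimately show ?thesis unfolding lcoset_def by auto
qed

theorem theorem2:
  fixes n r :: nat
    and Or :: "'a::euclidean_space list set"
    and L :: "'a set"
    and J :: "'a set \<Rightarrow> ('a \<Rightarrow>\<^sub>L 'a)"
  assumes "affine_BSV_torus n Or L J"
    and "has_twistor_rank L J r"
  shows "\<not> (\<exists>g. hermitian_metric L J g \<and> pluriclosed L J g)"
proof
  assume "\<exists>g. hermitian_metric L J g \<and> pluriclosed L J g"
  then obtain g where herm: "hermitian_metric L J g" and pluri: "pluriclosed L J g" by blast
  obtain q H K J0 f \<Gamma> OrK where lat: "full_lattice UNIV L"
    and q: "0 < q" and HK: "orth_decomp H K"
    and J0: "orth_complex_structure H J0"
    and f: "holomorphic_to_twistor_space H \<Gamma> J0 K OrK f"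
    and rank: "has_generic_complex_rank H \<Gamma> f q"
    and J: "\<And>h k. h \<in> H \<Longrightarrow> k \<in> K \<Longrightarrow> J (lcoset L (h + k)) = J0 + f (lcoset \<Gamma> h)"
    using assms(1) unfolding affine_BSV_torus_def Let_def by blast
  \<comment> \<open>The lift includes the projection to \<open>H\<close>, so \<open>F\<close> is
    defined on all of the vector space and is constant along \<open>K\<close>.\<close>
  define F where "F = torus_lift H \<Gamma> f"
  define Jl where "Jl x = J (lcoset L x)" for x
  define w where "w x a b = g (lcoset L x) (Jl x a) b" for x a b
  obtain T :: "'a \<Rightarrow> 'a" where T: "linear T" "surj T" "T ` Basis \<subseteq> L"
    using full_lattice_parametrization[OF lat] .
  have H: "subspace H" and K: "subspace K" and orth: "\<And>h k. h \<in> H \<Longrightarrow> k \<in> K \<Longrightarrow> h \<bullet> k = 0"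
    using HK unfolding orth_decomp_def orthogonal_def by auto
  have H0: "0 \<in> H" and K0: "0 \<in> K" using H K by (simp_all add: subspace_0)

  have F_eq: "F (h + k) = f (lcoset \<Gamma> h)" if "h \<in> H" "k \<in> K" for h k
    using that by (simp add: F_def torus_lift_def orth_proj_decomp[OF HK])
  have Jl_eq: "Jl x = J0 + F x" for x
    using orth_decomp_cases[OF HK, of x] J F_eq unfolding Jl_def by metis
  have F_K: "F (x + k) = F x" if "k \<in> K" for x k
  proof -
    obtain h' k' where hk: "h' \<in> H" "k' \<in> K" "x = h' + k'" by (rule orth_decomp_cases[OF HK])
    then show ?thesis
      using F_eq[of h' k'] F_eq[of h' "k' + k"] subspace_add[OF K _ that] by (simp add: add.assoc)
  qed
  have F_smooth: "smooth_inv K F"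
    using f F_K unfolding holomorphic_to_twistor_space_def smooth_inv_def F_def by blast
  have F_struct: "orth_complex_structure K (F x)" for x
  proof -
    obtain h' k' where hk: "h' \<in> H" "k' \<in> K" "x = h' + k'" by (rule orth_decomp_cases[OF HK])
    then have "lcoset \<Gamma> h' \<in> torus H \<Gamma>" by (simp add: torus_def)
    then show ?thesis
      using f hk F_eq unfolding holomorphic_to_twistor_space_def twistor_space_def by auto
  qed
  have FK: "F x k \<in> K" "F x (F x k) = - k" if "k \<in> K" for x k
    using F_struct that unfolding orth_complex_structure_def by auto
  have FH: "F x h = 0" if "h \<in> H" for x h
    using F_struct[of x] orth[OF that] unfolding orth_complex_structure_def orthogonal_def by auto
  have JH: "J0 h \<in> H" "J0 (J0 h) = - h" if "h \<in> H" for h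
    using J0 that unfolding orth_complex_structure_def by auto
  have JK: "J0 k = 0" if "k \<in> K" for k
    using J0 orth[OF _ that] unfolding orth_complex_structure_def orthogonal_def by (auto simp: inner_commute)
  have dF_K: "dirderiv v F x u \<in> K" for v x u
  proof -
    have F_all: "F y u \<in> K" for y
    proof -
      obtain h' k' where "h' \<in> H" "k' \<in> K" "u = h' + k'" by (rule orth_decomp_cases[OF HK])
      then show ?thesis using FH[of h' y] FK(1)[of k' y] by (simp add: blinfun.add_right)
    qed
    \<comment> \<open>Membership in \<open>K\<close> passes to the derivative because it is
      expressed by the linear equations of orthogonality to \<open>H\<close>.\<close>
    have perp: "dirderiv v F x u \<bullet> h = 0" if "h \<in> H" for h
    proof -
      have "dirderiv v (\<lambda>y. F y u \<bullet> h) x = dirderiv v F x u \<bullet> h"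
        by (rule dirderiv_linear[OF bounded_linear_compose[OF bounded_linear_inner_left bounded_linear_blinfun_eval]
              smooth_inv_differentiable[OF F_smooth]])
      moreover have "F y u \<bullet> h = 0" for y using orth[OF that F_all] by (simp add: inner_commute)
      ultimately show ?thesis by simp
    qed
    obtain h' k' where hk: "h' \<in> H" "k' \<in> K" "dirderiv v F x u = h' + k'" by (rule orth_decomp_cases[OF HK])
    have "k' \<bullet> h' = 0" using orth[OF hk(1,2)] by (simp add: inner_commute)
    then have "h' \<bullet> h' = 0" using perp[OF hk(1)] unfolding hk(3) inner_add_left by simp
    then show ?thesis using hk by simp
  qed
  have dJl: "dirderiv v Jl x = dirderiv v F x" for v x
  proof -
    have "dirderiv v (\<lambda>y. J0 + F y) x = dirderiv v (\<lambda>y. J0) x + dirderiv v F x"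
      by (rule dirderiv_add[OF differentiable_const smooth_inv_differentiable[OF F_smooth]])
    then show ?thesis by (simp add: Jl_eq[abs_def])
  qed
  have Jl_smooth: "smooth_inv (L \<union> K) Jl"
  proof -
    have "smooth_inv K Jl"
      unfolding Jl_eq[abs_def] using F_smooth by (intro smooth_inv_add) auto
    \<comment> \<open>Periodicity comes from \<open>J\<close> being a function of the coset.\<close>
    moreover have "Jl (x + l) = Jl x" if "l \<in> L" for x l
      unfolding Jl_def lcoset_shift[OF lat that] ..
    ultimately show ?thesis unfolding smooth_inv_def by blast
  qed
  have holo: "dirderiv (J0 h) F x = F x o\<^sub>L dirderiv h F x" if "h \<in> H" for h x
  proof -
    \<comment> \<open>Holomorphy of \<open>f\<close> is given at points of \<open>H\<close>;
      invariance under \<open>K\<close> carries it to every point.\<close>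
    obtain h' k' where hk: "h' \<in> H" "k' \<in> K" "x = h' + k'" by (rule orth_decomp_cases[OF HK])
    have "dirderiv (J0 h) F h' = F h' o\<^sub>L dirderiv h F h'"
      using f hk(1) that F_eq[OF hk(1) K0]
      unfolding holomorphic_to_twistor_space_def twistor_tangent_J_def dirderiv_def F_def by simp
    then show ?thesis
      using dirderiv_shift[of F k', OF F_K[OF hk(2)]] F_K[OF hk(2)] hk(3) by simp
  qed

  have gb: "bilinear (g (lcoset L x))" "g (lcoset L x) a b = g (lcoset L x) b a"
    "a \<noteq> 0 \<Longrightarrow> g (lcoset L x) a a > 0"
    "g (lcoset L x) (Jl x a) (Jl x b) = g (lcoset L x) a b" for x a b
    using herm unfolding hermitian_metric_def Jl_def torus_def by auto
  have g_smooth: "smooth_inv L (\<lambda>x. g (lcoset L x) a b)" for a b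
    using herm lcoset_shift[OF lat] unfolding hermitian_metric_def smooth_inv_def by simp
  have Jl_Jl: "Jl x (Jl x v) = - v" for x v
  proof -
    obtain h' k' where "h' \<in> H" "k' \<in> K" "v = h' + k'" by (rule orth_decomp_cases[OF HK])
    then show ?thesis
      using JH FH FK JK by (simp add: Jl_eq blinfun.add_left blinfun.add_right)
  qed

  interpret twisted_torus L Jl w H K T "blinfun_apply J0"
  proof (intro twisted_torus.intro smooth_2form.intro twisted_torus_axioms.intro)
    show "smooth_inv L Jl" using Jl_smooth smooth_inv_mono by blast
    show "Jl x (Jl x v) = - v" for x v by (rule Jl_Jl)
    show "linear (\<lambda>a. w x a b)" for x b
    proof -
      have "linear (\<lambda>a. g (lcoset L x) a b)" using gb(1) by (simp add: bilinear_def)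
      from linear_compose[OF bounded_linear.linear[OF blinfun.bounded_linear_right] this]
      show ?thesis by (simp add: w_def o_def)
    qed
    show "linear (\<lambda>b. w x a b)" for x a
      using gb(1) by (simp add: w_def bilinear_def)
    show "smooth_inv L (\<lambda>x. w x a b)" for a b
    proof -
      have "smooth_inv L (\<lambda>y. Jl y a)"
        using Jl_smooth smooth_inv_mono[of "L \<union> K" Jl L] by (intro smooth_inv_linear[OF bounded_linear_blinfun_eval]) auto
      then show ?thesis
        unfolding w_def using gb(1) g_smooth
        by (intro smooth_inv_apply[of L "\<lambda>y z. g (lcoset L y) z b" "\<lambda>y. Jl y a"]) (auto simp: bilinear_def)
    qed
    show "w x a b = - w x b a" for x a b
    proof -
      have "w x a b = g (lcoset L x) (Jl x (Jl x a)) (Jl x b)" by (simp add: w_def gb(4))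
      also have "\<dots> = - g (lcoset L x) a (Jl x b)" using bilinear_lneg[OF gb(1)] by (simp add: Jl_Jl)
      finally show ?thesis by (simp add: w_def gb(2)[of x a])
    qed
    show "T ` Basis \<subseteq> L" "linear T" "surj T" "subspace K" by fact+
    show "smooth_inv (L \<union> K) Jl" by fact
    show "Jl x k \<in> K" if "k \<in> K" for x k using that FK JK by (simp add: Jl_eq blinfun.add_left)
    show "Jl x h = J0 h" "J0 h \<in> H" if "h \<in> H" for x h
      using that FH JH by (simp_all add: Jl_eq blinfun.add_left)
    show "dirderiv v Jl x u \<in> K" for v x u by (simp add: dJl dF_K)
    show "dirderiv (J0 h) Jl x = Jl x o\<^sub>L dirderiv h Jl x" if "h \<in> H" for h x
      \<comment> \<open>\<open>Jl\<close> and \<open>F\<close> differ by \<open>J0\<close>, which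
        annihilates \<open>K\<close>, where the derivative of \<open>F\<close> takes its
        values.\<close>
      unfolding dJl holo[OF that] by (rule blinfun_eqI) (simp add: Jl_eq blinfun.add_left JK dF_K)
    show "w x (Jl x a) (Jl x b) = w x a b" for x a b by (simp add: w_def gb(4))
    show "w x v (Jl x v) > 0" if "v \<noteq> 0" for x v using gb(3)[OF that] by (simp add: w_def gb(4))
  qed

  have dJl_K: "dirderiv h Jl x k = 0" if h: "h \<in> H" and k: "k \<in> K" for h k x
  proof (rule dJ_vanishes[OF k h])
    fix y
    have "d3 (\<lambda>x. \<gamma> x) y k (Jl y k) h (Jl y h) = 0"
    proof (rule closed_if_pluriclosed)
      show "fundamental_form L J g y [a, b] = of_real (w y a b)" for y a b
        by (simp add: fundamental_form_def w_def Jl_def Let_def)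
      show "del Jl 1 2 (delbar Jl 1 1 (fundamental_form L J g)) y [k, Jl y k, h, Jl y h] = 0"
        using pluri unfolding pluriclosed_def Let_def Jl_def[abs_def] by simp
    qed
    then show "dirderiv k (\<lambda>z. \<gamma> z (Jl y k) h (J0 h)) y - dirderiv (Jl y k) (\<lambda>z. \<gamma> z k h (J0 h)) y
      + dirderiv h (\<lambda>z. \<gamma> z k (Jl y k) (J0 h)) y - dirderiv (J0 h) (\<lambda>z. \<gamma> z k (Jl y k) h) y = 0"
      unfolding d3_def J_H(1)[OF h] .
  qed
  have dF_H: "dirderiv h F x k = 0" if "k \<in> H" for h k x
    using dirderiv_blinfun_eval[OF F_smooth, of h k x] FH[OF that] by simp
  \<comment> \<open>On \<open>K\<close> this is the result of the integration; on \<open>H\<close>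
    it holds because every \<open>F x\<close> vanishes there.\<close>
  have dF0: "dirderiv h F x = 0" if "h \<in> H" for h x
  proof (intro blinfun_eqI)
    fix u
    obtain h' k' where "h' \<in> H" "k' \<in> K" "u = h' + k'" by (rule orth_decomp_cases[OF HK])
    then show "dirderiv h F x u = blinfun_apply 0 u"
      using dF_H dJl_K that by (simp add: blinfun.add_right dJl)
  qed
  obtain U where U: "H \<subseteq> closure U" and dimU: "\<And>x. x \<in> U \<Longrightarrow> dim (frechet_derivative F (at x) ` H) = 2 * q"
    using rank unfolding has_generic_complex_rank_def F_def by blast
  \<comment> \<open>At any point of the dense set \<open>U\<close> the differential would have image
    of real dimension 2 q > 0, but it is zero.\<close>
  have "U \<noteq> {}" using U H0 by auto
  then obtain x where "x \<in> U" by blast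
  moreover have "frechet_derivative F (at x) ` H = {0}"
    using dF0 H0 unfolding dirderiv_def by force
  ultimately have "dim {0 :: 'a \<Rightarrow>\<^sub>L 'a} = 2 * q" using dimU by metis
  moreover have "dim {0 :: 'a \<Rightarrow>\<^sub>L 'a} = 0"
    using dim_span[of "{} :: ('a \<Rightarrow>\<^sub>L 'a) set"] dim_eq_card_independent[OF independent_empty] by simp
  ultimately show False using q by simp
qed

end
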